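(* Let $G$ be a finite group and let $N$ be a normal subgroup of $G$. If the graph $\Gamma_G(N)$ has two connected components, then either $N$ is quasi-Frobenius with abelian kernel and abelian complement, or $N=P\times A$ where $P$ is a $p$-group for some prime $p$ and $A\leqslant \mathbf{Z}(G)$.
   Context: For a finite group $G$ and a normal subgroup $N$ of $G$, $\mathrm{Con}_G(N)$ denotes the set of $G$-conjugacy classes $x^G=\{x^g \mid g\in G\}$ of elements $x\in N$. A class $x^G$ is central if $x\in \mathbf{Z}(G)$ (equivalently $|x^G|=1$), and non-central otherwise. The graph $\Gamma_G(N)$ is the simple graph whose vertices are the non-central elements of $\mathrm{Con}_G(N)$, two distinct vertices $x^G$ and $y^G$ being joined by an edge if and only if $|x^G|$ and $|y^G|$ have a common prime divisor. A finite group $H$ is quasi-Frobenius if $H/\mathbf{Z}(H)$ is a Frobenius group; in this case the inverse images in $H$ of the Frobenius kernel and of a Frobenius complement of $H/\mathbf{Z}(H)$ are called the kernel and a complement of $H$, respectively. The decomposition $N=P\times A$ is an internal direct product of subgroups of $N$. *)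

theory Defs
  imports
    "HOL-Algebra.Group_Action"
    "HOL-Computational_Algebra.Primes"
    "Graph_Theory.Pair_Digraph"
    "Graph_Theory.Digraph_Component"
begin

definition center :: "('a, 'b) monoid_scheme \<Rightarrow> 'a set" where
  "center G = {z \<in> carrier G. \<forall>g\<in>carrier G. z \<otimes>\<^bsub>G\<^esub> g = g \<otimes>\<^bsub>G\<^esub> z}"

definition conj_class :: "('a, 'b) monoid_scheme \<Rightarrow> 'a \<Rightarrow> 'a set" where
  "conj_class G x = (\<lambda>g. inv\<^bsub>G\<^esub> g \<otimes>\<^bsub>G\<^esub> x \<otimes>\<^bsub>G\<^esub> g) ` carrier G"

text \<open>The symmetric loop-free digraph on the non-central \<open>G\<close>-classes of elements of \<open>N\<close>;
  every edge is represented by its two arcs.\<close>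

definition class_graph :: "('a, 'b) monoid_scheme \<Rightarrow> 'a set \<Rightarrow> 'a set pair_pre_digraph" where
  "class_graph G N =
    (let V = {conj_class G x | x. x \<in> N \<and> x \<notin> center G}
     in \<lparr> pverts = V,
          parcs = {(C, D). C \<in> V \<and> D \<in> V \<and> C \<noteq> D \<and>
                     (\<exists>p. prime p \<and> p dvd card C \<and> p dvd card D)} \<rparr>)"

text \<open>As the graph is symmetric, its connected components are its strongly connected ones.\<close>

definition components :: "'a pair_pre_digraph \<Rightarrow> 'a set set" where
  "components \<Gamma> = pre_digraph.sccs_verts (with_proj \<Gamma>)"

definition frobenius_complement :: "('a, 'b) monoid_scheme \<Rightarrow> 'a set \<Rightarrow> bool" where
  "frobenius_complement F C \<longleftrightarrow>
    subgroup C F \<and> C \<noteq> {\<one>\<^bsub>F\<^esub>} \<and> C \<noteq> carrier F \<and>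
    (\<forall>g \<in> carrier F - C. C \<inter> (\<lambda>c. inv\<^bsub>F\<^esub> g \<otimes>\<^bsub>F\<^esub> c \<otimes>\<^bsub>F\<^esub> g) ` C = {\<one>\<^bsub>F\<^esub>})"

definition frobenius_group :: "('a, 'b) monoid_scheme \<Rightarrow> bool" where
  "frobenius_group F \<longleftrightarrow> group F \<and> finite (carrier F) \<and> (\<exists>C. frobenius_complement F C)"

text \<open>The identity together with the elements lying in no conjugate of the complement
  \<open>C\<close>. By Frobenius' theorem this is a normal subgroup; it does not depend on the choice
  of \<open>C\<close>.\<close>

definition frobenius_kernel :: "('a, 'b) monoid_scheme \<Rightarrow> 'a set \<Rightarrow> 'a set" where
  "frobenius_kernel F C =
    insert \<one>\<^bsub>F\<^esub> (carrier F -
      (\<Union>g\<in>carrier F. (\<lambda>c. inv\<^bsub>F\<^esub> g \<otimes>\<^bsub>F\<^esub> c \<otimes>\<^bsub>F\<^esub> g) ` C))"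

definition central_preimage :: "('a, 'b) monoid_scheme \<Rightarrow> 'a set set \<Rightarrow> 'a set" where
  "central_preimage H S = {x \<in> carrier H. center H #>\<^bsub>H\<^esub> x \<in> S}"

definition quasi_frobenius :: "('a, 'b) monoid_scheme \<Rightarrow> bool" where
  "quasi_frobenius H \<longleftrightarrow>
    group H \<and> finite (carrier H) \<and> frobenius_group (H Mod center H)"

text \<open>\<open>K\<close> is the kernel and \<open>L\<close> a complement of the quasi-Frobenius group \<open>H\<close>.\<close>

definition quasi_frobenius_kernel_complement ::
    "('a, 'b) monoid_scheme \<Rightarrow> 'a set \<Rightarrow> 'a set \<Rightarrow> bool" where
  "quasi_frobenius_kernel_complement H K L \<longleftrightarrow>
    quasi_frobenius H \<and>
    (\<exists>C. frobenius_complement (H Mod center H) C \<and>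
         K = central_preimage H (frobenius_kernel (H Mod center H) C) \<and>
         L = central_preimage H C)"

definition p_group :: "nat \<Rightarrow> ('a, 'b) monoid_scheme \<Rightarrow> bool" where
  "p_group p H \<longleftrightarrow> prime p \<and> group H \<and> (\<exists>n. order H = p ^ n)"

definition internal_direct_product ::
    "('a, 'b) monoid_scheme \<Rightarrow> 'a set \<Rightarrow> 'a set \<Rightarrow> bool" where
  "internal_direct_product H P A \<longleftrightarrow>
    P \<lhd> H \<and> A \<lhd> H \<and> P \<inter> A = {\<one>\<^bsub>H\<^esub>} \<and> P <#>\<^bsub>H\<^esub> A = carrier H"

lemma (in group) conj_class_eq_orbit:
  assumes "x \<in> carrier G"
  shows "conj_class G x = orbit G (\<lambda>g. \<lambda>h \<in> carrier G. g \<otimes> h \<otimes> inv g) x"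
proof (intro equalityI subsetI)
  fix y assume "y \<in> conj_class G x"
  then obtain g where "g \<in> carrier G" "y = inv g \<otimes> x \<otimes> g"
    by (auto simp: conj_class_def)
  then show "y \<in> orbit G (\<lambda>g. \<lambda>h \<in> carrier G. g \<otimes> h \<otimes> inv g) x"
    using assms unfolding orbit_def by (auto intro!: exI[of _ "inv g"])
next
  fix y assume "y \<in> orbit G (\<lambda>g. \<lambda>h \<in> carrier G. g \<otimes> h \<otimes> inv g) x"
  then obtain g where "g \<in> carrier G" "y = g \<otimes> x \<otimes> inv g"
    using assms by (auto simp: orbit_def)
  then show "y \<in> conj_class G x"
    unfolding conj_class_def by (auto intro!: image_eqI[of _ _ "inv g"])
qed

lemma (in group) center_normal: "center G \<lhd> G"
proof -
  have "subgroup (center G) G"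
  proof (rule subgroupI)
    show "center G \<noteq> {}"
      by (auto simp: center_def intro!: exI[of _ \<one>])
  next
    fix a assume a: "a \<in> center G"
    have "inv a \<otimes> g = g \<otimes> inv a" if g: "g \<in> carrier G" for g
    proof -
      have ac: "a \<in> carrier G" and comm: "a \<otimes> inv g = inv g \<otimes> a"
        using a g by (auto simp: center_def)
      have "inv (inv g \<otimes> a) = inv (a \<otimes> inv g)"
        by (simp only: comm)
      then show ?thesis
        using ac g by (simp add: inv_mult_group)
    qed
    then show "inv a \<in> center G"
      using a by (simp add: center_def)
  next
    fix a b assume ab: "a \<in> center G" "b \<in> center G"
    then have carr: "a \<in> carrier G" "b \<in> carrier G"
      by (auto simp: center_def)
    have "a \<otimes> b \<otimes> g = g \<otimes> (a \<otimes> b)" if g: "g \<in> carrier G" for g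
    proof -
      have "a \<otimes> b \<otimes> g = a \<otimes> (b \<otimes> g)" using carr g by (rule m_assoc)
      also have "b \<otimes> g = g \<otimes> b" using ab g by (auto simp: center_def)
      also have "a \<otimes> (g \<otimes> b) = a \<otimes> g \<otimes> b" using carr g by (simp add: m_assoc)
      also have "a \<otimes> g = g \<otimes> a" using ab g by (auto simp: center_def)
      also have "g \<otimes> a \<otimes> b = g \<otimes> (a \<otimes> b)" using carr g by (simp add: m_assoc)
      finally show ?thesis .
    qed
    with carr show "a \<otimes> b \<in> center G"
      by (simp add: center_def)
  qed (auto simp: center_def)
  then show ?thesis
    by (rule normalI) (simp add: center_def r_coset_def l_coset_def)
qed

lemma class_graph_pair_graph:
  assumes "finite N"
  shows "pair_graph (class_graph G N)"
proof -
  have fin: "finite (pverts (class_graph G N))"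
    using assms by (simp add: class_graph_def Let_def setcompr_eq_image)
  have "parcs (class_graph G N) \<subseteq> pverts (class_graph G N) \<times> pverts (class_graph G N)"
    by (auto simp: class_graph_def Let_def)
  then have "finite (parcs (class_graph G N))"
    by (rule finite_subset) (simp add: fin)
  then show ?thesis
    using fin
  proof (unfold_locales, goal_cases)
    case 6
    then show ?case
      by (auto simp: class_graph_def Let_def symmetric_def intro!: symI)
  qed (auto simp: class_graph_def Let_def)
qed

end

theory Submission
  imports Defs "HOL-Algebra.Sylow" "HOL-Algebra.Multiplicative_Group"
begin

text \<open>The recurring device kills a commutator by showing that its order divides two coprime
  numbers, typically class sizes taken from the two parts or powers of them. It is what makes the
  quotient by the centre harmless: an element could be fixed modulo the centre without being fixed,
  the difference being a central commutator, and that commutator turns out to be trivial. The other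
  tool is the factorization of a group as \<open>C(x) C(y)\<close> when the class sizes of
  \<open>x\<close> and \<open>y\<close> are coprime. Two centres must be kept apart. Membership in
  \<open>X1\<close> or \<open>X2\<close> refers to \<open>Z(G)\<close>, whereas the quasi-Frobenius
  property refers to \<open>Z(N)\<close>, so an element of \<open>X2\<close> may well be central in
  \<open>N\<close>. Statements about fixed points therefore end with "commutes with all of
  \<open>N\<close>". Exponents of the form \<open>m ^ order G\<close> replace the splitting of an
  element into its primary parts: raising to such a power removes every prime divisor of
  \<open>m\<close> from the order of the element.\<close>

text \<open>Write the set of non-central elements of \<open>N\<close> as \<open>X1 \<union> X2\<close> according to the two components,
  where \<open>X2\<close> contains an element whose class \<open>B\<close> is of maximal size. Products \<open>x b\<close> with \<open>x \<in> X1\<close>,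
  \<open>b \<in> B\<close> lie in \<open>X2\<close>, so all commutators \<open>[x, g]\<close> lie in the normal subgroup \<open>{k. k B \<subseteq> B}\<close>,
  whose order divides \<open>|B|\<close>. Since \<open>|B|\<close> is coprime to the class sizes in \<open>X1\<close>, the elements of
  \<open>X1\<close> commute pairwise. Now let \<open>x0 \<in> X1\<close>. If some centralizer \<open>C\<^sub>N(x0)\<close> contains no element of
  \<open>X2\<close>, it is abelian and normal, and the elements outside act on it modulo \<open>Z(N)\<close> without fixed
  points. Otherwise commuting elements of coprime orders force all prime-power elements of \<open>X1\<close> to
  belong to one prime \<open>p\<close> and \<open>C\<^sub>N(x0)\<close> to be a \<open>p\<close>-group modulo \<open>Z(G)\<close>. Then either all of \<open>N\<close> is
  a \<open>p\<close>-group modulo \<open>Z(G)\<close>, which gives \<open>N = P \<times> A\<close>, or \<open>X2\<close> contains an element of order prime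
  to \<open>p\<close>; in that case \<open>C\<^sub>N(x0)\<close> is the same normal subgroup for all \<open>x0 \<in> X1\<close>, and an argument
  with its second centre shows that it is abelian, which leads to the quasi-Frobenius case again.\<close>

section \<open>Conjugation by a subgroup\<close>

context group
begin

definition conjugate :: "'a \<Rightarrow> 'a \<Rightarrow> 'a" where
  "conjugate x g = inv g \<otimes> x \<otimes> g"

text \<open>\<open>x\<close> need not belong to \<open>T\<close>: besides the whole group and
  \<open>N\<close>, the subgroup \<open>T\<close> will be a centralizer, the group
  \<open>stab\<close>, and the centralizer of \<open>stab\<close>.\<close>

definition class_in :: "'a set \<Rightarrow> 'a \<Rightarrow> 'a set" where
  "class_in T x = conjugate x ` T"

definition centralizer_in :: "'a set \<Rightarrow> 'a \<Rightarrow> 'a set" where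
  "centralizer_in T x = {t \<in> T. t \<otimes> x = x \<otimes> t}"

lemma conjugate_closed [simp, intro]: "x \<in> carrier G \<Longrightarrow> g \<in> carrier G \<Longrightarrow> conjugate x g \<in> carrier G"
  by (simp add: conjugate_def)

lemma conjugate_one [simp]: "x \<in> carrier G \<Longrightarrow> conjugate x \<one> = x"
  by (simp add: conjugate_def)

lemma one_conjugate [simp]: "g \<in> carrier G \<Longrightarrow> conjugate \<one> g = \<one>"
  by (simp add: conjugate_def)

lemma inv_mult_cancel [simp]:
  "x \<in> carrier G \<Longrightarrow> y \<in> carrier G \<Longrightarrow> inv x \<otimes> (x \<otimes> y) = y"
  "x \<in> carrier G \<Longrightarrow> y \<in> carrier G \<Longrightarrow> x \<otimes> (inv x \<otimes> y) = y"
  by (simp_all flip: m_assoc)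

lemma conjugate_mult: "x \<in> carrier G \<Longrightarrow> y \<in> carrier G \<Longrightarrow> g \<in> carrier G \<Longrightarrow> conjugate (x \<otimes> y) g = conjugate x g \<otimes> conjugate y g"
  by (simp add: conjugate_def m_assoc)

lemma conjugate_conjugate: "x \<in> carrier G \<Longrightarrow> g \<in> carrier G \<Longrightarrow> h \<in> carrier G \<Longrightarrow> conjugate (conjugate x g) h = conjugate x (g \<otimes> h)"
  by (simp add: conjugate_def inv_mult_group m_assoc)

lemma conjugate_pow: "x \<in> carrier G \<Longrightarrow> g \<in> carrier G \<Longrightarrow> conjugate (x [^] (n::nat)) g = conjugate x g [^] n"
  by (induction n) (simp_all add: conjugate_mult)

lemma mult_conjugate: "x \<in> carrier G \<Longrightarrow> g \<in> carrier G \<Longrightarrow> g \<otimes> conjugate x g = x \<otimes> g"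
  by (simp add: conjugate_def m_assoc)

lemma conjugate_eq_iff: "x \<in> carrier G \<Longrightarrow> g \<in> carrier G \<Longrightarrow> y \<in> carrier G \<Longrightarrow> conjugate x g = y \<longleftrightarrow> x \<otimes> g = g \<otimes> y"
  by (metis mult_conjugate conjugate_closed Units_eq Units_l_cancel)

lemma conjugate_eq_self_iff: "x \<in> carrier G \<Longrightarrow> g \<in> carrier G \<Longrightarrow> conjugate x g = x \<longleftrightarrow> g \<otimes> x = x \<otimes> g"
  using conjugate_eq_iff by metis

lemma conjugate_inj: "x \<in> carrier G \<Longrightarrow> y \<in> carrier G \<Longrightarrow> g \<in> carrier G \<Longrightarrow> conjugate x g = conjugate y g \<Longrightarrow> x = y"
  by (metis mult_conjugate right_cancel)

lemma conj_class_eq_class_in: "conj_class G x = class_in (carrier G) x"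
  by (simp add: conj_class_def class_in_def conjugate_def)

lemma commute_mult:
  "\<lbrakk>x \<in> carrier G; y \<in> carrier G; z \<in> carrier G; x \<otimes> z = z \<otimes> x; y \<otimes> z = z \<otimes> y\<rbrakk>
    \<Longrightarrow> x \<otimes> y \<otimes> z = z \<otimes> (x \<otimes> y)"
  by (metis m_assoc)

lemma commute_inv:
  "\<lbrakk>x \<in> carrier G; z \<in> carrier G; x \<otimes> z = z \<otimes> x\<rbrakk> \<Longrightarrow> inv x \<otimes> z = z \<otimes> inv x"
  by (metis inv_closed inv_solve_left m_assoc m_closed r_inv r_one)

lemma commute_pow:
  "\<lbrakk>x \<in> carrier G; z \<in> carrier G; x \<otimes> z = z \<otimes> x\<rbrakk> \<Longrightarrow> x [^] (n::nat) \<otimes> z = z \<otimes> x [^] n"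
  by (induction n) (simp_all add: commute_mult)

lemma centralizer_in_subset: "centralizer_in T x \<subseteq> T"
  by (auto simp: centralizer_in_def)

lemma centralizer_in_subgroup:
  assumes "subgroup T G" "x \<in> carrier G"
  shows "subgroup (centralizer_in T x) G"
proof -
  interpret T: subgroup T G by fact
  show ?thesis
    using assms(2) T.subset
    by (intro subgroupI) (auto simp: centralizer_in_def commute_inv commute_mult intro!: exI[of _ \<one>])
qed

section \<open>Class sizes relative to a subgroup\<close>

lemma mem_class_in: "y \<in> class_in T x \<longleftrightarrow> (\<exists>t\<in>T. y = conjugate x t)"
  by (auto simp: class_in_def)

lemma class_in_subset: "T \<subseteq> carrier G \<Longrightarrow> x \<in> carrier G \<Longrightarrow> class_in T x \<subseteq> carrier G"
  by (auto simp: class_in_def)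

lemma class_in_mono: "S \<subseteq> T \<Longrightarrow> class_in S x \<subseteq> class_in T x"
  by (auto simp: class_in_def)

lemma class_in_self: "subgroup T G \<Longrightarrow> x \<in> carrier G \<Longrightarrow> x \<in> class_in T x"
  unfolding class_in_def by (metis conjugate_one image_eqI subgroup.one_closed)

lemma finite_class_in: "finite T \<Longrightarrow> finite (class_in T x)"
  by (simp add: class_in_def)

lemma card_class_in_pos: "finite T \<Longrightarrow> subgroup T G \<Longrightarrow> x \<in> carrier G \<Longrightarrow> card (class_in T x) > 0"
  using class_in_self finite_class_in by (metis card_gt_0_iff empty_iff)

text \<open>Orbit-stabilizer: the fibres of \<open>conjugate x\<close> on \<open>T\<close> are the
  right cosets of the centralizer.\<close>

lemma card_class_in_mult_centralizer_in:
  assumes T: "subgroup T G" "finite T" and x: "x \<in> carrier G"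
  shows "card (class_in T x) * card (centralizer_in T x) = card T"
proof -
  interpret T: subgroup T G by fact
  have fib: "card {t \<in> T. conjugate x t = y} = card (centralizer_in T x)" if y: "y \<in> class_in T x" for y
  proof -
    obtain s where s: "s \<in> T" "y = conjugate x s"
      using y by (auto simp: class_in_def)
    have "{t \<in> T. conjugate x t = y} = (\<lambda>c. c \<otimes> s) ` centralizer_in T x"
    proof (intro equalityI subsetI)
      fix t assume "t \<in> {t \<in> T. conjugate x t = y}"
      then have t: "t \<in> T" "conjugate x t = conjugate x s" using s by auto
      have "conjugate x (t \<otimes> inv s) = x"
        using s t x conjugate_conjugate[of x t "inv s"] conjugate_conjugate[of x s "inv s"] by simp
      then have "t \<otimes> inv s \<in> centralizer_in T x"
        using s t x by (auto simp: centralizer_in_def conjugate_eq_self_iff)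
      moreover have "t = t \<otimes> inv s \<otimes> s"
        using s t by (simp add: m_assoc)
      ultimately show "t \<in> (\<lambda>c. c \<otimes> s) ` centralizer_in T x" by blast
    next
      fix t assume "t \<in> (\<lambda>c. c \<otimes> s) ` centralizer_in T x"
      then obtain c where c: "c \<in> T" "c \<otimes> x = x \<otimes> c" "t = c \<otimes> s"
        by (auto simp: centralizer_in_def)
      then have "conjugate x t = conjugate x s"
        using s x by (metis T.mem_carrier conjugate_conjugate conjugate_eq_self_iff)
      then show "t \<in> {t \<in> T. conjugate x t = y}" using s c by auto
    qed
    moreover have "inj_on (\<lambda>c. c \<otimes> s) (centralizer_in T x)"
      using s T.subset by (auto simp: inj_on_def centralizer_in_def)
    ultimately show ?thesis by (simp add: card_image)
  qed
  have "card T = (\<Sum>y\<in>conjugate x ` T. card {t \<in> T. conjugate x t = y})"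
    using sum.image_gen[OF T(2), of "\<lambda>_. 1::nat" "conjugate x"] by simp
  also have "\<dots> = card (class_in T x) * card (centralizer_in T x)"
    using fib by (simp add: class_in_def)
  finally show ?thesis by simp
qed

lemma card_class_in_eq_1:
  assumes T: "subgroup T G" "finite T" and x: "x \<in> carrier G" and 1: "card (class_in T x) = 1" and t: "t \<in> T"
  shows "t \<otimes> x = x \<otimes> t"
proof -
  have "class_in T x = {x}"
    using 1 class_in_self[OF T(1) x] by (metis card_1_singletonE singletonD)
  then have "conjugate x t = x" using t by (auto simp: class_in_def)
  then show ?thesis
    using conjugate_eq_self_iff t x T(1) by (metis subgroup.mem_carrier)
qed

text \<open>The index of \<open>C(x) \<inter> C(y)\<close> in \<open>T\<close> can be computed
  through \<open>C(x)\<close> or through \<open>C(y)\<close>. Comparing the two and using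
  coprimality, the size of the \<open>T\<close>-class of \<open>y\<close> divides that of its
  \<open>C(x)\<close>-class, so \<open>C(x)\<close> is already transitive on the
  \<open>T\<close>-class of \<open>y\<close>. Hence \<open>t\<close> agrees with some
  \<open>a\<close> in \<open>C(x)\<close> up to a factor from \<open>C(y)\<close>.\<close>

lemma coprime_class_in_decompose:
  assumes T: "subgroup T G" "finite T" and x: "x \<in> carrier G" and y: "y \<in> carrier G"
    and cop: "coprime (card (class_in T x)) (card (class_in T y))" and t: "t \<in> T"
  obtains b a where "b \<in> centralizer_in T y" "a \<in> centralizer_in T x" "t = b \<otimes> a"
proof -
  interpret T: subgroup T G by fact
  let ?A = "centralizer_in T x" and ?B = "centralizer_in T y"
  have A: "subgroup ?A G" "finite ?A" and B: "subgroup ?B G" "finite ?B"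
    using centralizer_in_subgroup[OF T(1)] finite_subset[OF centralizer_in_subset T(2)] x y by auto
  have AB: "centralizer_in ?A y = centralizer_in ?B x" by (auto simp: centralizer_in_def)
  have pos: "card (centralizer_in ?B x) > 0"
    using B x by (metis centralizer_in_subgroup centralizer_in_subset finite_subset subgroup.one_closed card_gt_0_iff empty_iff)
  have "card (class_in T x) * (card (class_in ?A y) * card (centralizer_in ?A y)) = card (class_in T y) * (card (class_in ?B x) * card (centralizer_in ?B x))"
    using card_class_in_mult_centralizer_in[OF T x] card_class_in_mult_centralizer_in[OF T y]
      card_class_in_mult_centralizer_in[OF A y] card_class_in_mult_centralizer_in[OF B x] by simp
  then have "card (class_in T x) * card (class_in ?A y) = card (class_in T y) * card (class_in ?B x)"
    using pos AB by (metis mult.assoc mult_cancel2 less_numeral_extra(3))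
  then have "card (class_in T y) dvd card (class_in ?A y)"
    using cop by (metis coprime_commute coprime_dvd_mult_right_iff dvd_triv_left)
  then have "card (class_in T y) \<le> card (class_in ?A y)"
    using card_class_in_pos A y by (simp add: dvd_imp_le)
  then have eq: "class_in ?A y = class_in T y"
    using class_in_mono[OF centralizer_in_subset] finite_class_in T by (metis card_seteq)
  obtain a where a: "a \<in> ?A" "conjugate y t = conjugate y a"
    using eq t mem_class_in by metis
  have aT: "a \<in> T" using a by (auto simp: centralizer_in_def)
  have "conjugate y (t \<otimes> inv a) = y"
    using a aT t y conjugate_conjugate[of y t "inv a"] conjugate_conjugate[of y a "inv a"] by simp
  then have "t \<otimes> inv a \<in> ?B"
    using aT t y by (auto simp: centralizer_in_def conjugate_eq_self_iff)
  moreover have "t = t \<otimes> inv a \<otimes> a"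
    using aT t by (simp add: m_assoc)
  ultimately show thesis using that a by blast
qed

text \<open>Coprimality of the class sizes gives \<open>T = C\<^sub>T(x) C\<^sub>T(y)\<close>, so elements of the two classes can be
  conjugated independently.\<close>

lemma coprime_class_in_mult:
  assumes T: "subgroup T G" "finite T" and x: "x \<in> carrier G" and y: "y \<in> carrier G"
    and cop: "coprime (card (class_in T x)) (card (class_in T y))"
    and u: "u \<in> class_in T x" and v: "v \<in> class_in T y"
  shows "u \<otimes> v \<in> class_in T (x \<otimes> y)"
proof -
  interpret T: subgroup T G by fact
  obtain g h where g: "g \<in> T" "u = conjugate x g" and h: "h \<in> T" "v = conjugate y h"
    using u v by (auto simp: class_in_def)
  obtain b a where b: "b \<in> centralizer_in T y" and a: "a \<in> centralizer_in T x" and ba: "h \<otimes> inv g = b \<otimes> a"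
    using coprime_class_in_decompose[OF T x y cop, of "h \<otimes> inv g"] g h by auto
  have ab: "a \<in> T" "b \<in> T" using a b by (auto simp: centralizer_in_def)
  \<comment> \<open>Besides \<open>a g\<close>, the element \<open>k\<close> is also
    \<open>b^-1 h\<close>. The first form shows that it takes \<open>x\<close> to \<open>u\<close>,
    the second that it takes \<open>y\<close> to \<open>v\<close>.\<close>
  define k where "k = a \<otimes> g"
  have k: "k \<in> T" using ab g by (simp add: k_def)
  have "h = h \<otimes> inv g \<otimes> g" using g h by (simp add: m_assoc)
  then have hk: "h = b \<otimes> k" using ba ab g by (simp add: k_def m_assoc)
  have "conjugate x k = u"
  proof -
    have "conjugate x a = x" using a ab x by (simp add: centralizer_in_def conjugate_eq_self_iff)
    then show ?thesis using ab g x by (simp add: k_def flip: conjugate_conjugate)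
  qed
  moreover have "conjugate y k = v"
  proof -
    have "conjugate y b = y" using b ab y by (simp add: centralizer_in_def conjugate_eq_self_iff)
    then show ?thesis using ab k h hk y by (simp flip: conjugate_conjugate)
  qed
  ultimately have "conjugate (x \<otimes> y) k = u \<otimes> v"
    using k x y by (simp add: conjugate_mult)
  then show ?thesis using k mem_class_in by metis
qed

lemma class_in_eq:
  assumes T: "subgroup T G" and x: "x \<in> carrier G" and y: "y \<in> class_in T x"
  shows "class_in T y = class_in T x"
proof -
  interpret T: subgroup T G by fact
  obtain g where g: "g \<in> T" "y = conjugate x g" using y by (auto simp: class_in_def)
  have "\<exists>s\<in>T. conjugate (conjugate x g) t = conjugate x s" if "t \<in> T" for t
    using that g x by (intro bexI[of _ "g \<otimes> t"]) (auto simp: conjugate_conjugate)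
  moreover have "\<exists>s\<in>T. conjugate x t = conjugate (conjugate x g) s" if "t \<in> T" for t
    using that g x by (intro bexI[of _ "inv g \<otimes> t"]) (auto simp: conjugate_conjugate)
  ultimately show ?thesis using g by (auto simp: class_in_def)
qed

text \<open>The \<open>T\<close>-class of \<open>x\<close> is a disjoint union of
  \<open>U\<close>-classes, and conjugation by \<open>T\<close> permutes these transitively because
  it normalizes \<open>U\<close>; so all have the same size.\<close>

lemma card_class_in_normal_dvd:
  assumes T: "subgroup T G" "finite T" and U: "subgroup U G" "U \<subseteq> T"
    and inv: "\<And>u t. u \<in> U \<Longrightarrow> t \<in> T \<Longrightarrow> conjugate u t \<in> U" and x: "x \<in> carrier G"
  shows "card (class_in U x) dvd card (class_in T x)"
proof -
  interpret T: subgroup T G by fact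
  interpret U: subgroup U G by fact
  have sub: "class_in T x \<subseteq> carrier G" using x T.subset class_in_subset by simp
  have un: "class_in T x = \<Union> (class_in U ` class_in T x)"
  proof (intro equalityI subsetI)
    fix y assume "y \<in> class_in T x"
    then show "y \<in> \<Union> (class_in U ` class_in T x)" using class_in_self[OF U(1)] sub by blast
  next
    fix z assume "z \<in> \<Union> (class_in U ` class_in T x)"
    then obtain y where "y \<in> class_in T x" "z \<in> class_in U y" by blast
    then show "z \<in> class_in T x" using class_in_eq[OF T(1) x] class_in_mono[OF U(2)] by blast
  qed
  have card: "card (class_in U y) = card (class_in U x)" if y: "y \<in> class_in T x" for y
  proof -
    obtain g where g: "g \<in> T" "y = conjugate x g" using y by (auto simp: class_in_def)
    have "class_in U y = (\<lambda>z. conjugate z g) ` class_in U x"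
    proof (intro equalityI subsetI)
      fix z assume "z \<in> class_in U y"
      then obtain u where u: "u \<in> U" "z = conjugate (conjugate x g) u" using g by (auto simp: class_in_def)
      have "z = conjugate (conjugate x (conjugate u (inv g))) g"
        using u g x by (simp add: conjugate_conjugate) (simp add: conjugate_def m_assoc)
      then show "z \<in> (\<lambda>z. conjugate z g) ` class_in U x"
        using inv[of u "inv g"] u g by (auto simp: class_in_def)
    next
      fix z assume "z \<in> (\<lambda>z. conjugate z g) ` class_in U x"
      then obtain u where u: "u \<in> U" "z = conjugate (conjugate x u) g" by (auto simp: class_in_def)
      have "z = conjugate (conjugate x g) (conjugate u g)"
        using u g x by (simp add: conjugate_conjugate mult_conjugate)
      then show "z \<in> class_in U y"
        using inv[of u g] u g by (auto simp: class_in_def)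
    qed
    moreover have "inj_on (\<lambda>z. conjugate z g) (class_in U x)"
      using class_in_subset[OF U.subset x] g by (meson inj_onI conjugate_inj T.mem_carrier subsetD)
    ultimately show ?thesis by (simp add: card_image)
  qed
  have "card (class_in U x) dvd card (\<Union> (class_in U ` class_in T x))"
  proof (rule dvd_partition)
    show "finite (\<Union> (class_in U ` class_in T x))" using un finite_class_in[OF T(2)] by metis
    show "\<forall>c\<in>class_in U ` class_in T x. card (class_in U x) dvd card c" using card by auto
    show "\<forall>c1\<in>class_in U ` class_in T x. \<forall>c2\<in>class_in U ` class_in T x. c1 \<noteq> c2 \<longrightarrow> c1 \<inter> c2 = {}"
      using class_in_eq[OF U(1)] sub by blast
  qed
  then show ?thesis using un by simp
qed

text \<open>\<open>X\<close> is a disjoint union of right cosets of \<open>K\<close>. This serves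
  both for nested subgroups and for the action of \<open>stab\<close> on the class of
  \<open>b0\<close>.\<close>

lemma card_subgroup_dvd_stable:
  assumes K: "subgroup K G" and X: "X \<subseteq> carrier G" "finite X"
    and st: "\<And>k x. k \<in> K \<Longrightarrow> x \<in> X \<Longrightarrow> k \<otimes> x \<in> X"
  shows "card K dvd card X"
proof -
  interpret K: subgroup K G by fact
  have un: "X = \<Union> ((\<lambda>x. K #> x) ` X)"
    using st X by (force simp: r_coset_def intro!: bexI[of _ \<one>])
  have "card K dvd card (\<Union> ((\<lambda>x. K #> x) ` X))"
  proof (rule dvd_partition)
    show "finite (\<Union> ((\<lambda>x. K #> x) ` X))" using un X by metis
    show "\<forall>c\<in>(\<lambda>x. K #> x) ` X. card K dvd card c"
    proof (intro ballI)
      fix c assume "c \<in> (\<lambda>x. K #> x) ` X"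
      then have "c \<in> rcosets K" using X rcosetsI[OF K.subset] by blast
      then show "card K dvd card c" by (simp add: card_rcosets_equal[OF _ K.subset, symmetric])
    qed
    show "\<forall>c1\<in>(\<lambda>x. K #> x) ` X. \<forall>c2\<in>(\<lambda>x. K #> x) ` X. c1 \<noteq> c2 \<longrightarrow> c1 \<inter> c2 = {}"
      using X rcos_disjoint[OF K] rcosetsI[OF K.subset] by (auto simp: pairwise_def disjnt_def)
  qed
  then show ?thesis using un by simp
qed

lemma ord_dvd_stable:
  assumes fin: "finite (carrier G)" and k: "k \<in> carrier G" and X: "X \<subseteq> carrier G"
    and st: "\<And>x. x \<in> X \<Longrightarrow> k \<otimes> x \<in> X"
  shows "ord k dvd card X"
proof -
  have "k [^] (n::nat) \<otimes> x \<in> X" if "x \<in> X" for n x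
    using that
  proof (induction n arbitrary: x)
    case 0
    then show ?case using X by auto
  next
    case (Suc n)
    then have "k [^] n \<otimes> (k \<otimes> x) \<in> X" using st by blast
    then show ?case using k X Suc.prems by (simp add: m_assoc subsetD)
  qed
  then have "h \<otimes> x \<in> X" if "h \<in> generate G {k}" "x \<in> X" for h x
    using that by (auto simp: generate_pow_on_finite_carrier[OF fin k])
  then have "card (generate G {k}) dvd card X"
    using fin X k by (intro card_subgroup_dvd_stable) (auto simp: generate_is_subgroup finite_subset)
  then show ?thesis using generate_pow_card[OF k] by simp
qed

text \<open>Since \<open>T\<close> centralizes \<open>k\<close>, conjugating
  \<open>x^t = k x\<close> by \<open>s\<close> gives \<open>x^(t s) = k x^s\<close>; so left
  multiplication by \<open>k\<close> maps the class into itself. This yields one of the two divisors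
  of the order of a commutator.\<close>

lemma ord_commutator_dvd_class_in:
  assumes fin: "finite (carrier G)" and T: "subgroup T G" and x: "x \<in> carrier G" and k: "k \<in> carrier G"
    and t: "t \<in> T" "conjugate x t = k \<otimes> x" and comm: "\<And>s. s \<in> T \<Longrightarrow> s \<otimes> k = k \<otimes> s"
  shows "ord k dvd card (class_in T x)"
proof (rule ord_dvd_stable[OF fin k])
  interpret T: subgroup T G by fact
  show "class_in T x \<subseteq> carrier G" using x by (simp add: class_in_subset T.subset)
  fix y assume "y \<in> class_in T x"
  then obtain s where s: "s \<in> T" "y = conjugate x s" by (auto simp: class_in_def)
  have "conjugate x (t \<otimes> s) = conjugate (k \<otimes> x) s" using s t x by (metis T.mem_carrier conjugate_conjugate)
  also have "\<dots> = k \<otimes> y" using s k x comm by (simp add: conjugate_mult conjugate_eq_self_iff)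
  finally show "k \<otimes> y \<in> class_in T x" using s t by (metis T.m_closed class_in_def imageI)
qed

end

section \<open>Element orders and \<open>p\<close>-groups\<close>

text \<open>Factors \<open>gcd c m\<close> are split off until the rest is coprime to
  \<open>m\<close>. Every step strictly decreases the cofactor, so \<open>c\<close> is a sufficient
  exponent for the collected part.\<close>

lemma coprime_part_decomposition:
  fixes c m :: nat
  assumes "c > 0"
  obtains a b where "c = a * b" "a dvd m ^ c" "coprime b m"
proof -
  have "\<exists>a b. c = a * b \<and> a dvd m ^ c \<and> coprime b m"
    using assms
  proof (induction c rule: less_induct)
    case (less c)
    show ?case
    proof (cases "coprime c m")
      case True
      then show ?thesis by (intro exI[of _ 1] exI[of _ c]) simp
    next
      case False
      define d where "d = gcd c m"
      have d: "d > 1" using False less.prems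
        by (metis coprime_iff_gcd_eq_1 d_def gcd_pos_nat less_one linorder_neqE_nat not_less_zero)
      obtain c' where c': "c = d * c'" by (metis d_def dvdE gcd_dvd1)
      have pos: "c' > 0" "c' < c" using c' d less.prems by auto
      obtain a b where ab: "c' = a * b" "a dvd m ^ c'" "coprime b m"
        using less.IH pos by blast
      have "d * a dvd m ^ Suc c'"
        using ab(2) by (simp add: d_def mult_dvd_mono)
      also have "\<dots> dvd m ^ c" using pos by (intro le_imp_power_dvd) simp
      finally show ?thesis using ab c'
        by (intro exI[of _ "d * a"] exI[of _ b]) simp
    qed
  qed
  then show thesis using that by blast
qed

lemma only_prime_divisor_imp_power:
  fixes n p :: nat
  assumes "n > 0" "prime p" "\<And>q. prime q \<Longrightarrow> q dvd n \<Longrightarrow> q = p"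
  obtains e where "n = p ^ e"
proof -
  obtain m where m: "n = p ^ multiplicity p n * m" "\<not> p dvd m"
    using multiplicity_decompose'[of n p] assms by (metis neq0_conv not_prime_unit)
  have "m = 1"
  proof (rule ccontr)
    assume "m \<noteq> 1"
    then obtain q where q: "prime q" "q dvd m" using prime_factor_nat by blast
    then have "q dvd n" using m(1) by (metis dvd_mult)
    then show False using assms(3) q m(2) by blast
  qed
  then show thesis using that m(1) by simp
qed

section \<open>Powers, commuting elements of coprime orders, and centres of
  \<open>p\<close>-groups\<close>

context group
begin

lemma subgroup_pow_closed: "subgroup T G \<Longrightarrow> x \<in> T \<Longrightarrow> x [^] (n::nat) \<in> T"
  by (induction n) (auto simp: subgroup.one_closed subgroup.m_closed)

lemma subgroup_mem_coprime_pow: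
  assumes T: "subgroup T G" and x: "x \<in> carrier G" and m: "x [^] (m::nat) \<in> T" and n: "x [^] n \<in> T"
    and cop: "coprime m n"
  shows "x \<in> T"
\<comment> \<open>If \<open>m = 0\<close>, coprimality means \<open>n = 1\<close>. Otherwise Bezout
  writes \<open>x\<close> as a quotient of a power of \<open>x^m\<close> by a power of
  \<open>x^n\<close>.\<close>
proof (cases "m = 0")
  case True
  then show ?thesis using cop n x by simp
next
  case False
  then obtain k l where kl: "m * k = n * l + 1"
    using bezout_nat[of m n] cop by auto
  have "x [^] (m * k) \<in> T" "x [^] (n * l) \<in> T"
    using T m n x by (simp_all flip: nat_pow_pow add: subgroup_pow_closed)
  moreover have "x = inv (x [^] (n * l)) \<otimes> x [^] (m * k)"
    using x kl by simp
  ultimately show ?thesis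
    using T by (metis subgroup.m_closed subgroup.m_inv_closed)
qed

lemma pow_coprime_eq_one:
  assumes "x \<in> carrier G" "x [^] (m::nat) = \<one>" "x [^] n = \<one>" "coprime m n"
  shows "x = \<one>"
  using subgroup_mem_coprime_pow[OF triv_subgroup, of x m n] assms by simp

text \<open>The centralizer of \<open>g\<close> contains \<open>(u v)^(ord v) = u^(ord v)\<close>,
  and \<open>ord v\<close> is prime to \<open>ord u\<close>, so it contains
  \<open>u\<close>.\<close>

lemma commute_of_commute_mult_coprime:
  assumes u: "u \<in> carrier G" and v: "v \<in> carrier G" and g: "g \<in> carrier G"
    and uv: "u \<otimes> v = v \<otimes> u" and cop: "coprime (ord u) (ord v)"
    and guv: "g \<otimes> (u \<otimes> v) = (u \<otimes> v) \<otimes> g"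
  shows "g \<otimes> u = u \<otimes> g"
proof -
  have T: "subgroup (centralizer_in (carrier G) g) G" using centralizer_in_subgroup[OF subgroup_self g] .
  have "u \<otimes> v \<in> centralizer_in (carrier G) g" using guv u v by (simp add: centralizer_in_def)
  then have "(u \<otimes> v) [^] ord v \<in> centralizer_in (carrier G) g" using T subgroup_pow_closed by blast
  then have 1: "u [^] ord v \<in> centralizer_in (carrier G) g"
    using u v uv by (simp add: pow_mult_distrib)
  have 2: "u [^] ord u \<in> centralizer_in (carrier G) g"
    using T u by (simp add: subgroup.one_closed)
  have "u \<in> centralizer_in (carrier G) g"
    using subgroup_mem_coprime_pow[OF T u 1 2] cop by (simp add: coprime_commute)
  then show ?thesis by (simp add: centralizer_in_def)
qed

text \<open>The exponent \<open>m ^ order G\<close> absorbs the part of the group order built from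
  prime divisors of \<open>m\<close>. The power thus plays the role of the part of \<open>x\<close>
  of order prime to \<open>m\<close>, without any decomposition of \<open>x\<close>.\<close>

lemma coprime_ord_pow_order:
  assumes fin: "finite (carrier G)" and x: "x \<in> carrier G"
  shows "coprime (ord (x [^] (m ^ order G))) m"
proof -
  have "order G > 0" using fin by (simp add: order_gt_0_iff_finite)
  then obtain a b where ab: "order G = a * b" "a dvd m ^ order G" "coprime b m"
    by (rule coprime_part_decomposition)
  have "order G dvd m ^ order G * b" using ab by (metis mult_dvd_mono dvd_refl)
  then have "(x [^] (m ^ order G)) [^] b = \<one>"
    using x ord_dvd_group_order[OF x] by (simp add: nat_pow_pow pow_eq_id dvd_trans)
  then have "ord (x [^] (m ^ order G)) dvd b" using x by (simp add: pow_eq_id)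
  then show ?thesis using ab(3) coprime_divisors dvd_refl by blast
qed

text \<open>If all primary parts of \<open>x\<close> were in \<open>T\<close>, so would be
  \<open>x\<close>. In the induction \<open>n = p^e m\<close>: when the \<open>p\<close>-part
  \<open>x^m\<close> lies in \<open>T\<close>, the power \<open>x^(p^e)\<close> does not, and it is
  annihilated by the smaller exponent \<open>m\<close>.\<close>

lemma exists_prime_power_part_notin:
  assumes T: "subgroup T G" and n: "n > 0" "x [^] (n::nat) = \<one>" and x: "x \<in> carrier G" "x \<notin> T"
  obtains p k e :: nat where "prime p" "x [^] k \<notin> T" "(x [^] k) [^] (p ^ e) = \<one>"
proof -
  have "\<exists>(p::nat) (k::nat) (e::nat). prime p \<and> x [^] k \<notin> T \<and> (x [^] k) [^] (p ^ e) = \<one>"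
    using n x
  proof (induction n arbitrary: x rule: less_induct)
    case (less n)
    have "n \<noteq> 1" using less.prems T by (metis nat_pow_eone subgroup.one_closed)
    then obtain p where p: "prime p" "p dvd n" using prime_factor_nat by blast
    define e where "e = multiplicity p n"
    obtain m where m: "n = p ^ e * m" "\<not> p dvd m"
      unfolding e_def using multiplicity_decompose'[of n p] less.prems p by (metis neq0_conv not_prime_unit)
    show ?case
    proof (cases "x [^] m \<in> T")
      case False
      moreover have "(x [^] m) [^] (p ^ e) = \<one>"
        using less.prems m by (simp add: nat_pow_pow mult.commute)
      ultimately show ?thesis using p by blast
    next
      case True
      have "coprime (p ^ e) m" using p m(2) by (simp add: prime_imp_coprime)
      then have x': "x [^] (p ^ e) \<notin> T"
        using subgroup_mem_coprime_pow[OF T less.prems(3) _ True] less.prems by blast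
      have "e > 0" using m p by (cases e) auto
      then have "1 < p ^ e" using one_less_power[OF prime_gt_1_nat[OF p(1)]] by blast
      moreover have "m > 0" using m(1) less.prems(1) by (cases m) auto
      ultimately have "m < n" "m > 0" using m(1) by (metis mult_1 mult_less_mono1, simp)
      moreover have "(x [^] (p ^ e)) [^] m = \<one>"
        using less.prems m by (simp add: nat_pow_pow)
      ultimately obtain q k f :: nat where
        "prime q" "(x [^] (p ^ e)) [^] k \<notin> T" "((x [^] (p ^ e)) [^] k) [^] (q ^ f) = \<one>"
        using less.IH[of m "x [^] (p ^ e)"] x' less.prems(3) by blast
      then show ?thesis using less.prems(3) by (metis nat_pow_pow)
    qed
  qed
  then show thesis using that by blast
qed

text \<open>Since \<open>u\<close> and \<open>k\<close> commute, conjugating \<open>u^m\<close> by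
  \<open>v\<close> multiplies it by \<open>k^m\<close>. This yields the other divisor of the order
  of a commutator.\<close>

lemma commutator_pow_eq_one:
  assumes u: "u \<in> carrier G" and v: "v \<in> carrier G" and k: "k \<in> carrier G"
    and uv: "conjugate u v = u \<otimes> k" and uk: "u \<otimes> k = k \<otimes> u" and comm: "v \<otimes> u [^] (m::nat) = u [^] m \<otimes> v"
  shows "k [^] m = \<one>"
proof -
  have "u [^] m \<otimes> k [^] m = conjugate u v [^] m"
    using pow_mult_distrib[OF uk u k] uv by simp
  also have "\<dots> = u [^] m"
    using u v comm by (simp flip: conjugate_pow add: conjugate_eq_self_iff)
  finally show ?thesis using u k by simp
qed

text \<open>Class equation: with a trivial centre, all classes of non-identity elements would have
  size divisible by \<open>p\<close>, and \<open>p\<close> would divide both \<open>order G\<close>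
  and \<open>order G - 1\<close>.\<close>

lemma p_group_center_nontrivial:
  assumes p: "prime p" and ord: "order G = p ^ e" and e: "carrier G \<noteq> {\<one>}"
  obtains a where "a \<in> center G" "a \<noteq> \<one>"
proof (rule ccontr)
  assume neg: "\<not> thesis"
  note found = that
  have triv: "x = \<one>" if "x \<in> center G" for x using neg found[OF that] by blast
  have fin: "finite (carrier G)"
    using ord p by (metis order_gt_0_iff_finite prime_gt_0_nat zero_less_power)
  note SG = subgroup_self
  have pdvd: "p dvd card (class_in (carrier G) x)" if x: "x \<in> carrier G" "x \<noteq> \<one>" for x
  proof -
    have "card (class_in (carrier G) x) \<noteq> 1"
      using card_class_in_eq_1[OF SG fin x(1)] triv[of x] x by (auto simp: center_def)
    moreover have "card (class_in (carrier G) x) dvd p ^ e"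
      using card_class_in_mult_centralizer_in[OF SG fin x(1)] ord by (metis dvd_triv_left order_def)
    ultimately show ?thesis using p
      by (metis divides_primepow_nat dvd_power not_gr0 power_0)
  qed
  have un: "carrier G - {\<one>} = \<Union> (class_in (carrier G) ` (carrier G - {\<one>}))"
  proof (intro equalityI subsetI)
    fix x assume "x \<in> carrier G - {\<one>}"
    then show "x \<in> \<Union> (class_in (carrier G) ` (carrier G - {\<one>}))" using class_in_self[OF SG] by blast
  next
    fix x assume "x \<in> \<Union> (class_in (carrier G) ` (carrier G - {\<one>}))"
    then obtain y g where y: "y \<in> carrier G" "y \<noteq> \<one>" "g \<in> carrier G" "x = conjugate y g"
      by (auto simp: mem_class_in)
    then have "x \<noteq> \<one>" using conjugate_inj[of y \<one> g] by auto
    then show "x \<in> carrier G - {\<one>}" using y by auto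
  qed
  have "p dvd card (\<Union> (class_in (carrier G) ` (carrier G - {\<one>})))"
  proof (rule dvd_partition)
    show "finite (\<Union> (class_in (carrier G) ` (carrier G - {\<one>})))" using un fin by (metis finite_Diff)
    show "\<forall>c\<in>class_in (carrier G) ` (carrier G - {\<one>}). p dvd card c" using pdvd by blast
    show "\<forall>c1\<in>class_in (carrier G) ` (carrier G - {\<one>}). \<forall>c2\<in>class_in (carrier G) ` (carrier G - {\<one>}).
        c1 \<noteq> c2 \<longrightarrow> c1 \<inter> c2 = {}"
      using class_in_eq[OF SG] by blast
  qed
  then have "p dvd order G - 1" using un fin by (simp add: order_def)
  moreover have "order G > 1"
    using e fin by (metis One_nat_def card_1_singletonE one_closed order_def order_gt_0_iff_finite singletonD
        less_one linorder_neqE_nat neq0_conv)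
  then have "p dvd order G" using ord p by (metis dvd_power nat_neq_iff not_gr0 power_0)
  ultimately have "p dvd 1"
    using \<open>order G > 1\<close> by (metis dvd_diffD1 less_imp_le)
  then show False using p by simp
qed

text \<open>\<open>a\<close> represents a nontrivial central element of the quotient by the centre.
  The group only has to be a \<open>p\<close>-group modulo some central subgroup \<open>Z\<close>:
  in the application \<open>Z\<close> is \<open>N \<inter> Z(G)\<close>, while the centre of the
  group in question can be larger.\<close>

lemma exists_second_center_element:
  assumes fin: "finite (carrier G)" and p: "prime p" and Z: "subgroup Z G" "Z \<subseteq> center G"
    and ord: "order G = p ^ e * card Z" and ne: "center G \<noteq> carrier G"
  obtains a where "a \<in> carrier G" "a \<notin> center G"
    "\<And>r. r \<in> carrier G \<Longrightarrow> \<exists>z\<in>center G. conjugate a r = a \<otimes> z"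
proof -
  interpret C: normal "center G" G by (rule center_normal)
  let ?Q = "G Mod center G"
  interpret Q: group ?Q by (rule C.factorgroup_is_group)
  have Zpos: "card Z > 0" using Z fin by (simp add: subgroup.finite_imp_card_positive)
  have "card Z dvd card (center G)"
  proof (rule card_subgroup_dvd_stable[OF Z(1) C.subset])
    show "finite (center G)" using fin C.subset finite_subset by blast
    show "k \<otimes> x \<in> center G" if "k \<in> Z" "x \<in> center G" for k x
      using that Z C.m_closed by blast
  qed
  then obtain j where j: "card (center G) = card Z * j" by blast
  have "order ?Q * card (center G) = p ^ e * card Z"
    using lagrange[OF C.subgroup_axioms] ord by (simp add: order_def FactGroup_def)
  then have "(order ?Q * j) * card Z = p ^ e * card Z" using j by (simp only: mult_ac)
  then have "order ?Q * j = p ^ e" using Zpos by simp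
  then obtain f where f: "order ?Q = p ^ f"
    using p by (metis divides_primepow_nat dvd_triv_left)
  have "carrier ?Q \<noteq> {\<one>\<^bsub>?Q\<^esub>}"
  proof
    assume 1: "carrier ?Q = {\<one>\<^bsub>?Q\<^esub>}"
    have "x \<in> center G" if x: "x \<in> carrier G" for x
    proof -
      have "center G #> x = center G" using 1 x by (auto simp: carrier_FactGroup)
      then show ?thesis using rcos_self[OF x C.subgroup_axioms] by simp
    qed
    then show False using ne C.subset by blast
  qed
  then obtain X where X: "X \<in> center ?Q" "X \<noteq> \<one>\<^bsub>?Q\<^esub>"
    using Q.p_group_center_nontrivial[OF p f] by blast
  then have "X \<in> carrier ?Q" unfolding center_def by blast
  then obtain a where a: "a \<in> carrier G" "X = center G #> a"
    unfolding carrier_FactGroup by blast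
  have "a \<notin> center G" using X a C.rcos_const by auto
  moreover have "\<exists>z\<in>center G. conjugate a r = a \<otimes> z" if r: "r \<in> carrier G" for r
  proof -
    have "X \<otimes>\<^bsub>?Q\<^esub> (center G #> r) = (center G #> r) \<otimes>\<^bsub>?Q\<^esub> X"
      using X(1) r unfolding center_def carrier_FactGroup by blast
    then have "center G #> (a \<otimes> r) = center G #> (r \<otimes> a)"
      using a r C.rcos_sum[OF a(1) r] C.rcos_sum[OF r a(1)] by simp
    then have "a \<otimes> r \<in> center G #> (r \<otimes> a)"
      using rcos_self[OF _ C.subgroup_axioms, of "a \<otimes> r"] a r by simp
    then obtain z where z: "z \<in> center G" "a \<otimes> r = z \<otimes> (r \<otimes> a)"
      by (auto simp: r_coset_def)
    have zc: "z \<in> carrier G" using z C.subset by blast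
    have "z \<otimes> (r \<otimes> a) = (r \<otimes> a) \<otimes> z"
      using z a r unfolding center_def by blast
    then have "a \<otimes> r = r \<otimes> (a \<otimes> z)" using z a r zc by (simp add: m_assoc)
    then have "conjugate a r = a \<otimes> z" using a r zc by (simp add: conjugate_eq_iff)
    then show ?thesis using z by blast
  qed
  ultimately show thesis using that a by blast
qed

end

section \<open>Exponent and order of a factor group\<close>

context normal
begin

lemma pow_card_rcosets_mem:
  assumes x: "x \<in> carrier G"
  shows "x [^] card (rcosets H) \<in> H"
proof -
  interpret Q: group "G Mod H" by (rule factorgroup_is_group)
  have X: "H #> x \<in> carrier (G Mod H)" using x by (auto simp: carrier_FactGroup)
  have "(H #> x) [^]\<^bsub>G Mod H\<^esub> order (G Mod H) = H"
    using Q.pow_order_eq_1[OF X] by simp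
  moreover have "order (G Mod H) = card (rcosets H)" by (simp add: order_def FactGroup_def)
  ultimately have "H #> (x [^] card (rcosets H)) = H"
    using x by (simp add: FactGroup_pow)
  then show ?thesis using rcos_self[OF _ subgroup_axioms, of "x [^] card (rcosets H)"] x by simp
qed

text \<open>Cauchy's theorem in the factor group, obtained from a Sylow subgroup of order
  \<open>q\<close>: a nontrivial element with \<open>q\<close>-th power one cannot also have
  \<open>P\<close>-th power one for \<open>P\<close> prime to \<open>q\<close>.\<close>

lemma prime_dvd_card_rcosets_imp_dvd_exponent:
  assumes fin: "finite (carrier G)" and q: "prime q" "q dvd card (rcosets H)"
    and exp: "\<And>x. x \<in> carrier G \<Longrightarrow> x [^] (P::nat) \<in> H"
  shows "q dvd P"
proof (rule ccontr)
  assume nd: "\<not> q dvd P"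
  let ?Q = "G Mod H"
  interpret Q: group ?Q by (rule factorgroup_is_group)
  have finQ: "finite (carrier ?Q)" using fin by (simp add: carrier_FactGroup)
  obtain m where "order ?Q = q ^ 1 * m" using q by (auto simp: order_def FactGroup_def)
  then obtain K where K: "subgroup K ?Q" "card K = q ^ 1"
    using sylow_thm[OF q(1) Q.group_axioms _ finQ] by blast
  have "card K > 1" using K prime_gt_1_nat[OF q(1)] by simp
  then obtain X where X: "X \<in> K" "X \<noteq> \<one>\<^bsub>?Q\<^esub>"
    by (metis One_nat_def card.empty card_Suc_eq empty_iff is_singletonI' is_singleton_altdef
        less_one not_less_iff_gr_or_eq subsetI subset_singletonD card_1_singleton_iff)
  have Xc: "X \<in> carrier ?Q" using X K subgroup.subset by blast
  then obtain x where x: "x \<in> carrier G" "X = H #> x" by (auto simp: carrier_FactGroup)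
  have 1: "X [^]\<^bsub>?Q\<^esub> P = \<one>\<^bsub>?Q\<^esub>"
    using x exp[OF x(1)] by (simp add: FactGroup_pow rcos_const)
  interpret K: group "?Q\<lparr>carrier := K\<rparr>" using K(1) by (rule Q.subgroup_imp_group)
  have "X [^]\<^bsub>?Q\<lparr>carrier := K\<rparr>\<^esub> q = \<one>\<^bsub>?Q\<^esub>"
    using K.pow_order_eq_1[of X] X K by (simp add: order_def)
  then have 2: "X [^]\<^bsub>?Q\<^esub> q = \<one>\<^bsub>?Q\<^esub>"
    using Q.nat_pow_consistent by metis
  show False
    using Q.pow_coprime_eq_one[OF Xc 1 2] X nd q(1) prime_imp_coprime coprime_commute by blast
qed

end

section \<open>A criterion for quasi-Frobenius groups\<close>

text \<open>\<open>S\<close> becomes the kernel and the centralizer \<open>L\<close> of one outside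
  element \<open>y\<close> a complement. Hypothesis \<open>central\<close> makes outside elements
  act on \<open>S\<close> with only central fixed points, and \<open>comm_one\<close> carries this
  over to the quotient by the centre: commuting with \<open>x\<close> modulo the centre is commuting
  with \<open>x\<close>. Hypothesis \<open>decomp\<close> says that conjugation of an outside
  element by the whole group reduces to conjugation by \<open>S\<close>.\<close>

lemma (in group) quasi_frobenius_criterion:
  assumes fin: "finite (carrier G)" and S: "S \<lhd> G"
    and comm: "\<And>s t. s \<in> S \<Longrightarrow> t \<in> S \<Longrightarrow> s \<otimes> t = t \<otimes> s"
    and y: "y \<in> carrier G" "y \<notin> S" and s0: "s0 \<in> S" "s0 \<notin> center G"
    and central: "\<And>x s. x \<in> carrier G \<Longrightarrow> x \<notin> S \<Longrightarrow> s \<in> S \<Longrightarrow> x \<otimes> s = s \<otimes> x \<Longrightarrow> s \<in> center G"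
    and decomp: "\<And>x h. x \<in> carrier G \<Longrightarrow> x \<notin> S \<Longrightarrow> h \<in> carrier G \<Longrightarrow>
      \<exists>c\<in>centralizer_in (carrier G) x. \<exists>s\<in>S. h = c \<otimes> s"
    and comm_one: "\<And>x s z. x \<in> carrier G \<Longrightarrow> x \<notin> S \<Longrightarrow> s \<in> S \<Longrightarrow> z \<in> center G \<Longrightarrow>
      conjugate x s = x \<otimes> z \<Longrightarrow> z = \<one>"
  defines "L \<equiv> centralizer_in (carrier G) y"
  shows "quasi_frobenius_kernel_complement G S L"
    and "\<And>l l'. l \<in> L \<Longrightarrow> l' \<in> L \<Longrightarrow> l \<otimes> l' = l' \<otimes> l"
proof -
  define Z where "Z = center G"
  interpret S: normal S G by fact
  interpret Z: normal Z G unfolding Z_def by (rule center_normal)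
  have L: "subgroup L G" unfolding L_def using centralizer_in_subgroup[OF subgroup_self y(1)] .
  interpret L: subgroup L G by (rule L)
  have Zc: "z \<otimes> x = x \<otimes> z" if "z \<in> Z" "x \<in> carrier G" for z x
    using that unfolding Z_def center_def by blast
  \<comment> \<open>A central element outside \<open>S\<close> would commute with \<open>s0\<close>
    and so force \<open>s0\<close> to be central.\<close>
  have ZS: "z \<in> S" if z: "z \<in> Z" for z
  proof (rule ccontr)
    assume "z \<notin> S"
    moreover have "z \<otimes> s0 = s0 \<otimes> z" using Zc[OF z] s0 S.mem_carrier by blast
    ultimately show False using central[of z s0] z s0 Z.mem_carrier by blast
  qed
  have ZL: "z \<in> L" if z: "z \<in> Z" for z
    using Zc[OF z y(1)] Z.mem_carrier[OF z] unfolding L_def centralizer_in_def by blast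
  have LS: "l \<in> Z" if "l \<in> L" "l \<in> S" for l
  proof -
    have "y \<otimes> l = l \<otimes> y" using that(1) unfolding L_def centralizer_in_def by force
    then show ?thesis using central[OF y that(2)] unfolding Z_def by blast
  qed
  have Scj: "conjugate s x \<in> S" if "s \<in> S" "x \<in> carrier G" for s x
    using that S.inv_op_closed1 by (simp add: conjugate_def)
  have comm_S: "inv l \<otimes> conjugate l s \<in> S" if "l \<in> carrier G" "s \<in> S" for l s
  proof -
    have "inv l \<otimes> conjugate l s = conjugate (inv s) l \<otimes> s"
      using that by (simp add: conjugate_def m_assoc)
    then show ?thesis using that Scj by simp
  qed
  \<comment> \<open>The commutator of \<open>l\<close> and \<open>s\<close> lies in \<open>S\<close>
    by normality and in \<open>L\<close> by assumption, so it is central and \<open>comm_one\<close>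
    makes it trivial. Then \<open>l\<close>, which is outside \<open>S\<close>, commutes with
    \<open>s\<close>.\<close>
  have centralizer_in_mod: "s \<in> Z" if l: "l \<in> L" "l \<notin> Z" and s: "s \<in> S" "inv l \<otimes> conjugate l s \<in> L" for l s
  proof -
    have lS: "l \<in> carrier G" "l \<notin> S" using l LS by auto
    define z where "z = inv l \<otimes> conjugate l s"
    have z: "z \<in> Z" using LS comm_S lS s z_def by blast
    have eq: "conjugate l s = l \<otimes> z" using lS s by (simp add: z_def)
    have "z = \<one>" using comm_one[OF lS s(1) _ eq] z unfolding Z_def by blast
    then have "s \<otimes> l = l \<otimes> s" using eq lS s conjugate_eq_self_iff[of l s] by simp
    then show ?thesis using central[OF lS s(1)] unfolding Z_def by metis
  qed
  show Lcomm: "l \<otimes> l' = l' \<otimes> l" if l: "l \<in> L" "l' \<in> L" for l l'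
  proof (cases "l \<in> Z")
    case True
    then show ?thesis using Zc L.mem_carrier[OF l(2)] by blast
  next
    case False
    then have lS: "l \<notin> S" using LS l(1) by blast
    \<comment> \<open>With \<open>l' = c s\<close> and \<open>c\<close> centralizing
      \<open>l\<close>, the commutators of \<open>l\<close> with \<open>l'\<close> and with
      \<open>s\<close> coincide. The former lies in \<open>L\<close>, so \<open>s\<close> is central
      and \<open>l'\<close> inherits commutation with \<open>l\<close> from
      \<open>c\<close>.\<close>
    obtain c s where c: "c \<in> centralizer_in (carrier G) l" and s: "s \<in> S" "l' = c \<otimes> s"
      using decomp[OF L.mem_carrier[OF l(1)] lS L.mem_carrier[OF l(2)]] by blast
    have cc: "c \<in> carrier G" "c \<otimes> l = l \<otimes> c" using c by (simp_all add: centralizer_in_def)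
    have lc: "l \<in> carrier G" using l by simp
    have "conjugate l l' = conjugate (conjugate l c) s" using cc s lc by (simp add: conjugate_conjugate)
    also have "conjugate l c = l" using cc lc conjugate_eq_self_iff by blast
    finally have "conjugate l l' = conjugate l s" .
    then have "inv l \<otimes> conjugate l s = inv l \<otimes> conjugate l l'" by simp
    also have "\<dots> \<in> L" using l by (simp add: conjugate_def)
    finally have "s \<in> Z" using centralizer_in_mod[OF l(1) False s(1)] by blast
    then have "s \<otimes> l = l \<otimes> s" using Zc lc by blast
    then have "c \<otimes> s \<otimes> l = l \<otimes> (c \<otimes> s)"
      using commute_mult[OF cc(1) S.mem_carrier[OF s(1)] lc cc(2)] by blast
    then show ?thesis using s by simp
  qed

  let ?F = "G Mod Z"
  define C where "C = (\<lambda>x. Z #> x) ` L"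
  interpret F: group ?F by (rule Z.factorgroup_is_group)
  have finF: "finite (carrier ?F)" using fin by (simp add: carrier_FactGroup)
  have rc_eq: "Z #> a = Z #> b \<longleftrightarrow> (\<exists>z\<in>Z. a = z \<otimes> b)" if "a \<in> carrier G" "b \<in> carrier G" for a b
  proof
    assume "Z #> a = Z #> b"
    then have "a \<in> Z #> b" using rcos_self[OF that(1) Z.subgroup_axioms] by simp
    then show "\<exists>z\<in>Z. a = z \<otimes> b" by (auto simp: r_coset_def)
  next
    assume "\<exists>z\<in>Z. a = z \<otimes> b"
    then have "a \<in> Z #> b" by (auto simp: r_coset_def)
    then show "Z #> a = Z #> b" using repr_independence[OF _ that(2) Z.subgroup_axioms] by simp
  qed
  have rc_one: "Z #> a = Z \<longleftrightarrow> a \<in> Z" if "a \<in> carrier G" for a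
    using rc_eq[OF that one_closed] Z.mem_carrier by (auto simp: coset_mult_one[OF Z.subset])
  have mem_C: "Z #> x \<in> C \<longleftrightarrow> x \<in> L" if x: "x \<in> carrier G" for x
  proof
    assume "Z #> x \<in> C"
    then obtain l where "l \<in> L" "Z #> x = Z #> l" by (auto simp: C_def)
    then obtain z where "z \<in> Z" "x = z \<otimes> l" using rc_eq x by auto
    then show "x \<in> L" using ZL \<open>l \<in> L\<close> by simp
  qed (simp add: C_def)
  have conj_F: "inv\<^bsub>?F\<^esub> (Z #> g) \<otimes>\<^bsub>?F\<^esub> (Z #> x) \<otimes>\<^bsub>?F\<^esub> (Z #> g) = Z #> conjugate x g"
    if "x \<in> carrier G" "g \<in> carrier G" for x g
  proof -
    have "Z #> g \<in> carrier ?F" using that by (auto simp: carrier_FactGroup)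
    then have "inv\<^bsub>?F\<^esub> (Z #> g) = Z #> inv g"
      using that by (simp add: Z.inv_FactGroup Z.rcos_inv)
    then show ?thesis using that by (simp add: Z.rcos_sum conjugate_def)
  qed
  \<comment> \<open>Writing \<open>g = c s\<close> with \<open>c\<close> in the abelian group
    \<open>L\<close>, conjugation of \<open>l\<close> by \<open>g\<close> is conjugation by
    \<open>s\<close>; so \<open>s\<close> is central and \<open>g\<close> would lie in
    \<open>L\<close>.\<close>
  have malnormal: "l \<in> Z" if l: "l \<in> L" "conjugate l g \<in> L" and g: "g \<in> carrier G" "g \<notin> L" for l g
  proof (rule ccontr)
    assume lZ: "l \<notin> Z"
    obtain c s where c: "c \<in> L" and s: "s \<in> S" "g = c \<otimes> s"
      using decomp[OF y g(1)] unfolding L_def by blast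
    have "conjugate l g = conjugate (conjugate l c) s" using c s l by (simp add: conjugate_conjugate)
    also have "conjugate l c = l" using Lcomm[OF c l(1)] conjugate_eq_self_iff L.mem_carrier c l by blast
    finally have "conjugate l g = conjugate l s" .
    then have "inv l \<otimes> conjugate l s \<in> L" using l by simp
    then have "s \<in> Z" using centralizer_in_mod[OF l(1) lZ s(1)] by blast
    then show False using ZL c s g by simp
  qed
  have compl: "frobenius_complement ?F C"
    unfolding frobenius_complement_def
  proof (intro conjI ballI)
    show "subgroup C ?F"
      unfolding C_def using L group_hom.subgroup_img_is_subgroup[of G ?F "\<lambda>x. Z #> x" L] Z.r_coset_hom_Mod
      by (simp add: group_hom_def group_hom_axioms_def F.group_axioms group_axioms)
    have yL: "y \<in> L" using y unfolding L_def centralizer_in_def by blast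
    have "Z #> y \<in> C" "Z #> y \<noteq> Z"
      using yL y rc_one[OF y(1)] ZS unfolding C_def by blast+
    then show "C \<noteq> {\<one>\<^bsub>?F\<^esub>}" by auto
    have "Z #> s0 \<notin> C" using mem_C[OF S.mem_carrier[OF s0(1)]] s0 LS unfolding Z_def by blast
    then show "C \<noteq> carrier ?F" using S.mem_carrier[OF s0(1)] unfolding carrier_FactGroup by blast
  next
    fix X assume "X \<in> carrier ?F - C"
    then obtain g where g: "g \<in> carrier G" "X = Z #> g" "g \<notin> L"
      unfolding carrier_FactGroup C_def by blast
    show "C \<inter> (\<lambda>c. inv\<^bsub>?F\<^esub> X \<otimes>\<^bsub>?F\<^esub> c \<otimes>\<^bsub>?F\<^esub> X) ` C = {\<one>\<^bsub>?F\<^esub>}"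
    proof (intro equalityI subsetI)
      fix Y assume Y: "Y \<in> C \<inter> (\<lambda>c. inv\<^bsub>?F\<^esub> X \<otimes>\<^bsub>?F\<^esub> c \<otimes>\<^bsub>?F\<^esub> X) ` C"
      then obtain l where l: "l \<in> L" "Y = inv\<^bsub>?F\<^esub> X \<otimes>\<^bsub>?F\<^esub> (Z #> l) \<otimes>\<^bsub>?F\<^esub> X"
        unfolding C_def by blast
      then have Yl: "Y = Z #> conjugate l g" using conj_F[OF L.mem_carrier[OF l(1)] g(1)] g(2) by simp
      then have "conjugate l g \<in> L" using mem_C[of "conjugate l g"] Y g l by simp
      then have "l \<in> Z" using malnormal[OF l(1) _ g(1,3)] by blast
      then have "conjugate l g \<in> Z" using Z.inv_op_closed1 g by (simp add: conjugate_def)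
      then show "Y \<in> {\<one>\<^bsub>?F\<^esub>}" using Yl rc_one g l by simp
    next
      fix Y assume "Y \<in> {\<one>\<^bsub>?F\<^esub>}"
      then have Y: "Y = Z #> \<one>" by (simp add: coset_mult_one[OF Z.subset])
      then have YC: "Y \<in> C" by (simp add: C_def)
      have "Y = inv\<^bsub>?F\<^esub> X \<otimes>\<^bsub>?F\<^esub> Y \<otimes>\<^bsub>?F\<^esub> X"
        using conj_F[of \<one> g] g Y by simp
      then show "Y \<in> C \<inter> (\<lambda>c. inv\<^bsub>?F\<^esub> X \<otimes>\<^bsub>?F\<^esub> c \<otimes>\<^bsub>?F\<^esub> X) ` C" using YC by blast
    qed
  qed

  \<comment> \<open>Every outside element is conjugate to an element of \<open>L\<close> modulo
    \<open>Z\<close>, by counting: for \<open>x = c s\<close>, the products of the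
    \<open>S\<close>-class of \<open>c\<close> with \<open>Z\<close> number
    \<open>|S : Z| |Z| = |S|\<close> and all lie in the coset \<open>c S\<close>, hence fill it. So
    \<open>Z\<close> and the conjugates of \<open>c\<close> reach \<open>x\<close>.\<close>
  have conj_outside: "\<exists>l\<in>L. \<exists>t\<in>S. Z #> x = Z #> conjugate l t" if x: "x \<in> carrier G" "x \<notin> S" for x
  proof -
    obtain c s where c: "c \<in> L" and s: "s \<in> S" "x = c \<otimes> s"
      using decomp[OF y x(1)] unfolding L_def by blast
    have cS: "c \<notin> S" using x s by auto
    have cc: "c \<in> carrier G" using c by simp
    let ?W = "(\<lambda>(w, z). w \<otimes> z) ` (class_in S c \<times> Z)"
    have finS: "finite S" using fin S.subset finite_subset by blast
    have "centralizer_in S c = Z"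
    proof (intro equalityI subsetI)
      fix s assume "s \<in> centralizer_in S c"
      then have "s \<in> S" "c \<otimes> s = s \<otimes> c" unfolding centralizer_in_def by auto
      then show "s \<in> Z" using central[OF cc cS] unfolding Z_def by blast
    next
      fix z assume "z \<in> Z"
      then show "z \<in> centralizer_in S c" using ZS Zc cc unfolding centralizer_in_def by blast
    qed
    then have "card (class_in S c) * card Z = card S"
      using card_class_in_mult_centralizer_in[OF S.subgroup_axioms finS cc] by simp
    \<comment> \<open>Equal products give \<open>w = w' u\<close> with \<open>u\<close> central and
      \<open>w\<close>, \<open>w'\<close> conjugate under \<open>S\<close>, whence
      \<open>u = 1\<close> by \<open>comm_one\<close>.\<close>
    moreover have "inj_on (\<lambda>(w, z). w \<otimes> z) (class_in S c \<times> Z)"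
    proof (rule inj_onI, clarsimp)
      fix w z w' z' assume w: "w \<in> class_in S c" "w' \<in> class_in S c" and z: "z \<in> Z" "z' \<in> Z" and eq: "w \<otimes> z = w' \<otimes> z'"
      have zc: "z \<in> carrier G" "z' \<in> carrier G" using z Z.subset by auto
      have wc: "w \<in> carrier G" "w' \<in> carrier G" using w class_in_subset[OF S.subset cc] by auto
      define u where "u = z' \<otimes> inv z"
      have u: "u \<in> Z" using z by (simp add: u_def)
      have uc: "u \<in> carrier G" using u Z.subset by auto
      have "w = w \<otimes> z \<otimes> inv z" using zc wc by (simp add: m_assoc)
      then have wu: "w = w' \<otimes> u" using eq zc wc by (simp add: u_def m_assoc)
      have "w \<in> class_in S w'"
        using class_in_eq[OF S.subgroup_axioms cc w(2)] w(1) by simp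
      then obtain t where t: "t \<in> S" "w = conjugate w' t" by (auto simp: mem_class_in)
      obtain r where r: "r \<in> S" "w' = conjugate c r" using w by (auto simp: mem_class_in)
      have "w' \<notin> S"
      proof
        assume "w' \<in> S"
        then have "conjugate w' (inv r) \<in> S" using Scj r by simp
        then show False using r cc cS by (simp add: conjugate_conjugate)
      qed
      then have "u = \<one>"
        using comm_one[OF wc(2) _ t(1), of u] t wu u unfolding Z_def by blast
      then show "w = w' \<and> z = z'"
        using wu wc zc eq by simp
    qed
    ultimately have cardW: "card ?W = card S"
      by (simp add: card_image card_cartesian_product)
    have sub: "?W \<subseteq> (\<lambda>s. c \<otimes> s) ` S"
    proof clarsimp
      fix w z assume w: "w \<in> class_in S c" and z: "z \<in> Z"
      obtain r where r: "r \<in> S" "w = conjugate c r" using w by (auto simp: mem_class_in)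
      have "w \<otimes> z = c \<otimes> (inv c \<otimes> conjugate c r \<otimes> z)"
        using r cc z Z.mem_carrier by (simp add: m_assoc)
      then show "w \<otimes> z \<in> (\<lambda>s. c \<otimes> s) ` S"
        using comm_S[OF cc r(1)] ZS[OF z] by blast
    qed
    have "card ((\<lambda>s. c \<otimes> s) ` S) = card S"
      using cc by (intro card_image) (auto simp: inj_on_def)
    then have "?W = (\<lambda>s. c \<otimes> s) ` S"
      using card_subset_eq[OF _ sub] cardW finS by simp
    then have "x \<in> ?W" using s by blast
    then obtain t z where t: "t \<in> S" and z: "z \<in> Z" and xe: "x = conjugate c t \<otimes> z"
      by (auto simp: mem_class_in)
    have "x = z \<otimes> conjugate c t" using xe Zc[OF z, of "conjugate c t"] cc t by simp
    then have "Z #> x = Z #> conjugate c t" using rc_eq x cc t z by auto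
    then show ?thesis using c t by blast
  qed
  have kernel: "central_preimage G (frobenius_kernel ?F C) = S"
  proof (intro equalityI subsetI)
    fix x assume "x \<in> central_preimage G (frobenius_kernel ?F C)"
    then have x: "x \<in> carrier G" and k: "Z #> x \<in> frobenius_kernel ?F C"
      unfolding central_preimage_def Z_def by blast+
    show "x \<in> S"
    proof (rule ccontr)
      assume xS: "x \<notin> S"
      then have "Z #> x \<noteq> Z" using rc_one ZS x by blast
      moreover obtain l t where lt: "l \<in> L" "t \<in> S" "Z #> x = Z #> conjugate l t"
        using conj_outside x xS by blast
      then have "Z #> x = inv\<^bsub>?F\<^esub> (Z #> t) \<otimes>\<^bsub>?F\<^esub> (Z #> l) \<otimes>\<^bsub>?F\<^esub> (Z #> t)"
        using conj_F[OF L.mem_carrier S.mem_carrier] by simp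
      moreover have "Z #> t \<in> carrier ?F" using lt by (auto simp: carrier_FactGroup)
      moreover have "Z #> l \<in> C" using lt by (simp add: C_def)
      ultimately show False
        using k unfolding frobenius_kernel_def by auto
    qed
  next
    fix x assume xS: "x \<in> S"
    then have x: "x \<in> carrier G" by simp
    have "Z #> x \<in> frobenius_kernel ?F C"
    proof (cases "x \<in> Z")
      case True
      then show ?thesis using rc_one x by (simp add: frobenius_kernel_def)
    next
      case False
      have "Z #> x \<noteq> inv\<^bsub>?F\<^esub> X \<otimes>\<^bsub>?F\<^esub> c \<otimes>\<^bsub>?F\<^esub> X" if X: "X \<in> carrier ?F" and c: "c \<in> C" for X c
      proof
        assume eq: "Z #> x = inv\<^bsub>?F\<^esub> X \<otimes>\<^bsub>?F\<^esub> c \<otimes>\<^bsub>?F\<^esub> X"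
        obtain g where g: "g \<in> carrier G" "X = Z #> g" using X unfolding carrier_FactGroup by blast
        obtain l where l: "l \<in> L" "c = Z #> l" using c unfolding C_def by blast
        have "Z #> conjugate l g = Z #> x" using eq g l conj_F[OF L.mem_carrier[OF l(1)] g(1)] by simp
        then obtain z where z: "z \<in> Z" "conjugate l g = z \<otimes> x" using rc_eq[of "conjugate l g" x] x g(1) l(1) by auto
        \<comment> \<open>If \<open>x\<close> in \<open>S\<close> were congruent to a conjugate of
          \<open>l\<close> modulo \<open>Z\<close>, then \<open>l\<close> would lie in both
          \<open>S\<close> and \<open>L\<close>, hence in \<open>Z\<close>, and so would
          \<open>x\<close>.\<close>
        then have "conjugate l g \<in> S" using ZS xS by (metis S.m_closed)
        then have "conjugate (conjugate l g) (inv g) \<in> S" using Scj g by simp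
        then have "l \<in> S" using g l by (simp add: conjugate_conjugate)
        then have "l \<in> Z" using LS l by blast
        then have "conjugate l g = l" using Zc[of l g] conjugate_eq_self_iff[of l g] g l by simp
        then have "x = inv z \<otimes> l" using z x l Z.mem_carrier by (simp add: inv_solve_left)
        then show False using False z \<open>l \<in> Z\<close> by simp
      qed
      moreover have "Z #> x \<in> carrier ?F" using x by (auto simp: carrier_FactGroup)
      ultimately show ?thesis by (auto simp: frobenius_kernel_def)
    qed
    then show "x \<in> central_preimage G (frobenius_kernel ?F C)"
      using x unfolding central_preimage_def Z_def by blast
  qed
  have "central_preimage G C = {x \<in> carrier G. Z #> x \<in> C}"
    by (simp only: central_preimage_def Z_def)
  also have "\<dots> = L"
  proof (intro equalityI subsetI)
    fix x assume "x \<in> {x \<in> carrier G. Z #> x \<in> C}"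
    then have "x \<in> carrier G" "Z #> x \<in> C" by blast+
    then show "x \<in> L" using mem_C[of x] by blast
  next
    fix x assume "x \<in> L"
    then show "x \<in> {x \<in> carrier G. Z #> x \<in> C}" using mem_C[of x] L.mem_carrier[of x] by blast
  qed
  finally have "central_preimage G C = L" .
  then show "quasi_frobenius_kernel_complement G S L"
    unfolding quasi_frobenius_kernel_complement_def quasi_frobenius_def frobenius_group_def
    using compl kernel fin finF group_axioms F.group_axioms unfolding Z_def by auto
qed

section \<open>Partitions of the non-central classes into parts of coprime sizes\<close>

lemma (in group) center_subset: "center G \<subseteq> carrier G"
  unfolding center_def by blast

lemma (in group) center_subgroup: "subgroup (center G) G"
  using center_normal normal_imp_subgroup by blast

lemma (in group) center_commute: "z \<in> center G \<Longrightarrow> g \<in> carrier G \<Longrightarrow> z \<otimes> g = g \<otimes> z"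
  unfolding center_def by blast

lemma (in group) centerI: "z \<in> carrier G \<Longrightarrow> (\<And>g. g \<in> carrier G \<Longrightarrow> g \<otimes> z = z \<otimes> g) \<Longrightarrow> z \<in> center G"
  unfolding center_def by simp

text \<open>Class sizes are indices of centralizers, and indices divide along nested
  subgroups.\<close>

lemma (in group) card_class_in_dvd_of_centralizer_in_subset:
  assumes T: "subgroup T G" "finite T" and x: "x \<in> carrier G" and u: "u \<in> carrier G"
    and sub: "centralizer_in T x \<subseteq> centralizer_in T u"
  shows "card (class_in T u) dvd card (class_in T x)"
proof -
  have cx: "subgroup (centralizer_in T x) G" and cu: "subgroup (centralizer_in T u) G" using centralizer_in_subgroup T(1) x u by auto
  have fin: "finite (centralizer_in T u)" using finite_subset[OF centralizer_in_subset T(2)] .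
  have "card (centralizer_in T x) dvd card (centralizer_in T u)"
  proof (rule card_subgroup_dvd_stable[OF cx subgroup.subset[OF cu] fin])
    show "k \<otimes> y \<in> centralizer_in T u" if "k \<in> centralizer_in T x" "y \<in> centralizer_in T u" for k y
      using that sub subgroup.m_closed[OF cu] by blast
  qed
  then obtain j where j: "card (centralizer_in T u) = card (centralizer_in T x) * j" by blast
  have pos: "card (centralizer_in T x) > 0"
    using finite_subset[OF centralizer_in_subset T(2)] subgroup.one_closed[OF cx] by (metis card_gt_0_iff empty_iff)
  have "card (class_in T x) * card (centralizer_in T x) = card (class_in T u) * card (centralizer_in T u)"
    using card_class_in_mult_centralizer_in[OF T x] card_class_in_mult_centralizer_in[OF T u] by simp
  then have "card (class_in T x) * card (centralizer_in T x) = (card (class_in T u) * j) * card (centralizer_in T x)"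
    using j by (simp only: mult_ac)
  then show ?thesis using pos by simp
qed

text \<open>The parts are sets of elements, not of classes, and what survives of the graph is
  coprimality across them. \<open>b0_max\<close> is compared with \<open>X1\<close> because it
  enters through the counting in \<open>mult_class_b0\<close>, where too large a class would have to
  fit into the class of an element of \<open>X1\<close>.\<close>

locale coprime_class_partition = group G for G (structure) +
  fixes N X1 X2 b0
  assumes fin: "finite (carrier G)" and normal_N: "N \<lhd> G"
    and part: "N - center G = X1 \<union> X2"
    and coprime_parts: "\<And>x y. x \<in> X1 \<Longrightarrow> y \<in> X2 \<Longrightarrow>
      coprime (card (class_in (carrier G) x)) (card (class_in (carrier G) y))"
    and X1_nonempty: "X1 \<noteq> {}"
    and b0: "b0 \<in> X2"
    and b0_max: "\<And>x. x \<in> X1 \<Longrightarrow> card (class_in (carrier G) x) \<le> card (class_in (carrier G) b0)"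
begin

sublocale N: normal N G by (rule normal_N)

abbreviation "csize x \<equiv> card (class_in (carrier G) x)"

lemmas carrier_group = subgroup_self fin

lemma finite_N: "finite N"
  using fin N.subset finite_subset by blast

lemmas N_group = N.subgroup_axioms finite_N

section \<open>Closure properties of the two parts\<close>

lemma part_subset: "x \<in> X1 \<Longrightarrow> x \<in> N" "x \<in> X2 \<Longrightarrow> x \<in> N"
  using part by blast+

lemma part_carrier: "x \<in> X1 \<Longrightarrow> x \<in> carrier G" "x \<in> X2 \<Longrightarrow> x \<in> carrier G"
  using part_subset N.subset by blast+

lemma part_noncentral: "x \<in> X1 \<Longrightarrow> x \<notin> center G" "x \<in> X2 \<Longrightarrow> x \<notin> center G"
  using part by blast+

lemma part_cases: "x \<in> N \<Longrightarrow> x \<notin> center G \<Longrightarrow> x \<in> X1 \<or> x \<in> X2"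
  using part by blast

lemma csize_neq_1: "x \<in> carrier G \<Longrightarrow> x \<notin> center G \<Longrightarrow> csize x \<noteq> 1"
  using card_class_in_eq_1[OF carrier_group] centerI by blast

lemma csize_coprime_dvd:
  assumes "x \<in> X1" "y \<in> X2" "d dvd csize x" "d dvd csize y"
  shows "d = 1"
  using coprime_parts[OF assms(1,2)] assms(3,4) by (meson coprime_common_divisor_nat)

text \<open>A noncentral element has class size greater than one. If this size divides that of a
  member of \<open>X1\<close>, it cannot also be coprime to it, which excludes \<open>X2\<close>.
  Powers, inverses and conjugates stay in their part for this reason.\<close>

lemma in_X1:
  assumes "x \<in> X1" "u \<in> N" "u \<notin> center G" "csize u dvd csize x"
  shows "u \<in> X1"
  using assms part_cases[of u] csize_coprime_dvd[of x u "csize u"] csize_neq_1[of u] N.mem_carrier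
  by auto

lemma in_X2:
  assumes "x \<in> X2" "u \<in> N" "u \<notin> center G" "csize u dvd csize x"
  shows "u \<in> X2"
  using assms part_cases[of u] csize_coprime_dvd[of u x "csize u"] csize_neq_1[of u] N.mem_carrier
  by auto

lemma csize_pow_dvd: "x \<in> carrier G \<Longrightarrow> csize (x [^] (n::nat)) dvd csize x"
  by (rule card_class_in_dvd_of_centralizer_in_subset[OF carrier_group])
    (auto simp: centralizer_in_def intro: commute_pow[symmetric])

lemma csize_inv: "x \<in> carrier G \<Longrightarrow> csize (inv x) = csize x"
proof -
  have "csize (inv x) dvd csize x" if "x \<in> carrier G" for x
    using that by (intro card_class_in_dvd_of_centralizer_in_subset[OF carrier_group])
      (auto simp: centralizer_in_def intro: commute_inv[symmetric])
  then show "x \<in> carrier G \<Longrightarrow> csize (inv x) = csize x"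
    by (metis dvd_antisym inv_closed inv_inv)
qed

lemma pow_in_N: "x \<in> N \<Longrightarrow> x [^] (n::nat) \<in> N"
  using subgroup_pow_closed[OF N.subgroup_axioms] .

lemma pow_X1: "x \<in> X1 \<Longrightarrow> x [^] (n::nat) \<notin> center G \<Longrightarrow> x [^] n \<in> X1"
  by (rule in_X1[OF _ pow_in_N[OF part_subset(1)] _ csize_pow_dvd[OF part_carrier(1)]])

lemma pow_X2: "x \<in> X2 \<Longrightarrow> x [^] (n::nat) \<notin> center G \<Longrightarrow> x [^] n \<in> X2"
  by (rule in_X2[OF _ pow_in_N[OF part_subset(2)] _ csize_pow_dvd[OF part_carrier(2)]])

lemma inv_center_iff: "x \<in> carrier G \<Longrightarrow> inv x \<in> center G \<longleftrightarrow> x \<in> center G"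
  using subgroup.m_inv_closed[OF center_subgroup] by (metis inv_inv)

lemma inv_X1: "x \<in> X1 \<Longrightarrow> inv x \<in> X1"
  using in_X1[of x "inv x"] part_subset[of x] csize_inv[of x] part_carrier[of x] part_noncentral[of x]
    inv_center_iff[of x] N.m_inv_closed[of x] by simp

lemma inv_X2: "x \<in> X2 \<Longrightarrow> inv x \<in> X2"
  using in_X2[of x "inv x"] part_subset[of x] csize_inv[of x] part_carrier[of x] part_noncentral[of x]
    inv_center_iff[of x] N.m_inv_closed[of x] by simp

lemma conjugate_center: "z \<in> center G \<Longrightarrow> g \<in> carrier G \<Longrightarrow> conjugate z g = z"
  using conjugate_eq_self_iff[of z g] center_commute[of z g] subsetD[OF center_subset, of z] by simp

lemma conjugate_center_iff: "x \<in> carrier G \<Longrightarrow> g \<in> carrier G \<Longrightarrow> conjugate x g \<in> center G \<longleftrightarrow> x \<in> center G"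
  using conjugate_center[of "conjugate x g" "inv g"] conjugate_center[of x g] by (auto simp: conjugate_conjugate)

lemma conjugate_N: "x \<in> N \<Longrightarrow> g \<in> carrier G \<Longrightarrow> conjugate x g \<in> N"
  using N.inv_op_closed1 by (simp add: conjugate_def)

lemma csize_conjugate: "x \<in> carrier G \<Longrightarrow> g \<in> carrier G \<Longrightarrow> csize (conjugate x g) = csize x"
  using class_in_eq[OF subgroup_self, of x "conjugate x g"] unfolding class_in_def by simp

lemma conjugate_X1: "x \<in> X1 \<Longrightarrow> g \<in> carrier G \<Longrightarrow> conjugate x g \<in> X1"
  using in_X1[of x "conjugate x g"] part_subset[of x] part_carrier[of x] part_noncentral[of x]
    conjugate_N[of x g] conjugate_center_iff[of x g] csize_conjugate[of x g] by simp

lemma conjugate_X2: "x \<in> X2 \<Longrightarrow> g \<in> carrier G \<Longrightarrow> conjugate x g \<in> X2"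
  using in_X2[of x "conjugate x g"] part_subset[of x] part_carrier[of x] part_noncentral[of x]
    conjugate_N[of x g] conjugate_center_iff[of x g] csize_conjugate[of x g] by simp

lemma nsize_dvd: "x \<in> carrier G \<Longrightarrow> card (class_in N x) dvd csize x"
  by (rule card_class_in_normal_dvd[OF carrier_group N.subgroup_axioms N.subset conjugate_N])

lemma coprime_nsize: "x \<in> X1 \<Longrightarrow> y \<in> X2 \<Longrightarrow> coprime (card (class_in N x)) (card (class_in N y))"
  using coprime_parts nsize_dvd part_carrier by (meson coprime_divisors)

section \<open>The left stabilizer of the class of \<open>b0\<close>, and commutativity of
  \<open>X1\<close>\<close>

definition stab :: "'a set" where
  "stab = {k \<in> carrier G. \<forall>b\<in>class_in (carrier G) b0. k \<otimes> b \<in> class_in (carrier G) b0}"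

lemma b0_carrier: "b0 \<in> carrier G"
  using b0 part_carrier by blast

lemma class_b0: "b \<in> class_in (carrier G) b0 \<Longrightarrow> b \<in> X2 \<and> class_in (carrier G) b = class_in (carrier G) b0"
  using class_in_eq[OF subgroup_self b0_carrier] conjugate_X2[OF b0] mem_class_in by metis

lemma stab_subgroup: "subgroup stab G"
proof (rule subgroupI)
  let ?B = "class_in (carrier G) b0"
  have BG: "?B \<subseteq> carrier G" using class_in_subset b0_carrier by blast
  show "stab \<subseteq> carrier G" unfolding stab_def by blast
  have "\<one> \<in> stab" unfolding stab_def using BG by (auto simp: subset_iff)
  then show "stab \<noteq> {}" by blast
  show "k \<otimes> l \<in> stab" if "k \<in> stab" "l \<in> stab" for k l
    using that BG unfolding stab_def by (auto simp: m_assoc subset_iff)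
  show "inv k \<in> stab" if k: "k \<in> stab" for k
  proof -
    have kc: "k \<in> carrier G" and st: "(\<lambda>b. k \<otimes> b) ` ?B \<subseteq> ?B" using k unfolding stab_def by auto
    \<comment> \<open>Left multiplication by \<open>k\<close> is an injection of a finite set into
      itself, hence onto; this is why one inclusion in \<open>stab\<close> suffices for
      inverses.\<close>
    have "inj_on (\<lambda>b. k \<otimes> b) ?B"
      using kc BG by (intro inj_onI) (metis Units_eq Units_l_cancel subsetD)
    then have eq: "(\<lambda>b. k \<otimes> b) ` ?B = ?B"
      using st finite_class_in[OF fin] by (simp add: card_image card_subset_eq)
    have "inv k \<otimes> b \<in> ?B" if "b \<in> ?B" for b
    proof -
      have "b \<in> (\<lambda>b. k \<otimes> b) ` ?B" unfolding eq by (rule that)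
      then obtain b' where b': "b' \<in> ?B" "b = k \<otimes> b'" by (rule imageE) simp
      then have "b' \<in> carrier G" using BG by blast
      then show ?thesis using b' kc by simp
    qed
    then show ?thesis using kc unfolding stab_def by blast
  qed
qed

lemma stab_carrier: "k \<in> stab \<Longrightarrow> k \<in> carrier G"
  unfolding stab_def by blast

lemma conjugate_stab: assumes k: "k \<in> stab" and g: "g \<in> carrier G" shows "conjugate k g \<in> stab"
proof -
  let ?B = "class_in (carrier G) b0"
  have "conjugate k g \<otimes> b \<in> ?B" if b: "b \<in> ?B" for b
  proof -
    have bc: "b \<in> carrier G" using b class_b0 part_carrier by blast
    have cjB: "conjugate a h \<in> ?B" if "a \<in> ?B" "h \<in> carrier G" for a h
      using class_b0[OF that(1)] that(2) mem_class_in by metis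
    have "conjugate b (inv g) \<in> ?B" using cjB b g by blast
    then have "k \<otimes> conjugate b (inv g) \<in> ?B" using k unfolding stab_def by blast
    then have "conjugate (k \<otimes> conjugate b (inv g)) g \<in> ?B" using cjB g by blast
    then show ?thesis using bc g stab_carrier[OF k] by (simp add: conjugate_mult conjugate_conjugate)
  qed
  then show ?thesis unfolding stab_def using g stab_carrier[OF k] by blast
qed

lemma card_stab_dvd: "card stab dvd csize b0"
proof (rule card_subgroup_dvd_stable[OF stab_subgroup class_in_subset[OF order_refl b0_carrier] finite_class_in[OF fin]])
  show "k \<otimes> x \<in> class_in (carrier G) b0" if "k \<in> stab" "x \<in> class_in (carrier G) b0" for k x
    using that unfolding stab_def by blast
qed

text \<open>Since the class of \<open>b0\<close> is at least as large as that of \<open>x\<close>, the product of an element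
  of the two classes cannot lie in the part of \<open>x\<close>.\<close>

lemma mult_class_b0:
  assumes x: "x \<in> X1" and b: "b \<in> class_in (carrier G) b0"
  shows "x \<otimes> b \<in> X2"
proof (rule ccontr)
  assume nX2: "x \<otimes> b \<notin> X2"
  have bX: "b \<in> X2" and bB: "class_in (carrier G) b = class_in (carrier G) b0" using class_b0 b by auto
  have xc: "x \<in> carrier G" and bc: "b \<in> carrier G" using x bX part_carrier by auto
  have xbc: "x \<otimes> b \<in> carrier G" using xc bc by simp
  have b1: "csize b \<noteq> 1" using csize_neq_1 bc bX part_noncentral by blast
  have "x \<otimes> b \<notin> center G"
  proof
    assume z: "x \<otimes> b \<in> center G"
    \<comment> \<open>If \<open>x b\<close> is central, whatever commutes with \<open>x\<close>
      commutes with \<open>b = x^-1 (x b)\<close>.\<close>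
    have "centralizer_in (carrier G) x \<subseteq> centralizer_in (carrier G) b"
    proof
      fix g assume "g \<in> centralizer_in (carrier G) x"
      then have g: "g \<in> carrier G" "x \<otimes> g = g \<otimes> x" unfolding centralizer_in_def by auto
      have "inv x \<otimes> (x \<otimes> b) \<otimes> g = g \<otimes> (inv x \<otimes> (x \<otimes> b))"
        using commute_mult[OF inv_closed[OF xc] xbc g(1)] commute_inv[OF xc g]
          center_commute[OF z g(1)] by blast
      then have "b \<otimes> g = g \<otimes> b" using xc bc by simp
      then show "g \<in> centralizer_in (carrier G) b" using g(1) unfolding centralizer_in_def by simp
    qed
    then have "csize b dvd csize x"
      using card_class_in_dvd_of_centralizer_in_subset[OF carrier_group xc bc] by blast
    then show False using csize_coprime_dvd[OF x bX, of "csize b"] b1 by simp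
  qed
  then have xbX: "x \<otimes> b \<in> X1"
    using part_cases[of "x \<otimes> b"] nX2 part_subset x bX N.m_closed by blast
  \<comment> \<open>Now \<open>x b\<close> is in \<open>X1\<close> and \<open>b^-1\<close> in
    \<open>X2\<close>, so the product of \<open>x b\<close> with the whole class of
    \<open>b^-1\<close> stays in the class of \<open>x\<close>. That class is thus at least as large
    as the class of \<open>b\<close>, and by maximality the two sizes agree, against
    coprimality.\<close>
  have cop: "coprime (csize (x \<otimes> b)) (csize (inv b))"
    using coprime_parts[OF xbX inv_X2[OF bX]] .
  have sub: "(\<lambda>v. (x \<otimes> b) \<otimes> v) ` class_in (carrier G) (inv b) \<subseteq> class_in (carrier G) x"
  proof clarify
    fix v assume v: "v \<in> class_in (carrier G) (inv b)"
    have "(x \<otimes> b) \<otimes> v \<in> class_in (carrier G) ((x \<otimes> b) \<otimes> inv b)"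
      using coprime_class_in_mult[OF carrier_group xbc inv_closed[OF bc] cop class_in_self[OF subgroup_self xbc] v] .
    then show "(x \<otimes> b) \<otimes> v \<in> class_in (carrier G) x" using xc bc by (simp add: m_assoc)
  qed
  have "inj_on (\<lambda>v. (x \<otimes> b) \<otimes> v) (class_in (carrier G) (inv b))"
    using class_in_subset[OF order_refl inv_closed[OF bc]] xbc
    by (intro inj_onI) (metis Units_eq Units_l_cancel subsetD)
  then have "csize (inv b) \<le> csize x"
    using card_mono[OF finite_class_in[OF fin] sub] by (simp add: card_image)
  then have "csize x = csize b"
    using b0_max[OF x] bB csize_inv[OF bc] by simp
  then show False using csize_coprime_dvd[OF x bX, of "csize b"] b1 by simp
qed

text \<open>For \<open>b\<close> in the class of \<open>b0\<close>, the factor \<open>x^-1\<close>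
  is in \<open>X1\<close> and \<open>x b\<close> in \<open>X2\<close>. Conjugating only the first
  factor keeps the product in the class of \<open>x^-1 (x b) = b\<close>.\<close>

lemma commutator_in_stab:
  assumes x: "x \<in> X1" and h: "h \<in> carrier G"
  shows "conjugate (inv x) h \<otimes> x \<in> stab"
proof -
  have xc: "x \<in> carrier G" using x part_carrier by blast
  have "conjugate (inv x) h \<otimes> x \<otimes> b \<in> class_in (carrier G) b0" if b: "b \<in> class_in (carrier G) b0" for b
  proof -
    have bB: "class_in (carrier G) b = class_in (carrier G) b0" and bc: "b \<in> carrier G"
      using class_b0[OF b] part_carrier by auto
    have "conjugate (inv x) h \<otimes> (x \<otimes> b) \<in> class_in (carrier G) (inv x \<otimes> (x \<otimes> b))"
    proof (rule coprime_class_in_mult[OF carrier_group])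
      show "coprime (csize (inv x)) (csize (x \<otimes> b))"
        using coprime_parts[OF inv_X1[OF x] mult_class_b0[OF x b]] .
      show "conjugate (inv x) h \<in> class_in (carrier G) (inv x)" using h mem_class_in by blast
      show "x \<otimes> b \<in> class_in (carrier G) (x \<otimes> b)" using class_in_self[OF subgroup_self] xc bc by simp
    qed (use xc bc in auto)
    then show ?thesis using xc bc h bB by (simp add: m_assoc)
  qed
  then show ?thesis unfolding stab_def using xc h by simp
qed

text \<open>The \<open>stab\<close>-class of \<open>x\<close> has size dividing both the class size
  of \<open>x\<close>, by normality of \<open>stab\<close>, and the order of \<open>stab\<close>,
  which divides the class size of \<open>b0\<close>.\<close>

lemma stab_centralizes_X1:
  assumes x: "x \<in> X1" and k: "k \<in> stab"
  shows "k \<otimes> x = x \<otimes> k"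
proof -
  have xc: "x \<in> carrier G" using x part_carrier by blast
  have finK: "finite stab" using finite_subset[OF subgroup.subset[OF stab_subgroup] fin] .
  have "card (class_in stab x) dvd csize x"
    using card_class_in_normal_dvd[OF carrier_group stab_subgroup subgroup.subset[OF stab_subgroup] conjugate_stab xc] .
  moreover have "card (class_in stab x) dvd csize b0"
    using card_class_in_mult_centralizer_in[OF stab_subgroup finK xc] card_stab_dvd by (metis dvd_trans dvd_triv_left)
  ultimately have "card (class_in stab x) = 1"
    using csize_coprime_dvd[OF x b0] by blast
  then show ?thesis using card_class_in_eq_1[OF stab_subgroup finK xc _ k] by blast
qed

text \<open>The commutator \<open>k\<close> lies in \<open>stab\<close>, so its order divides the
  class size of \<open>b0\<close>. On the other hand \<open>t\<close> lies in the normal subgroup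
  \<open>T\<close>, the centralizer of \<open>stab\<close>; as \<open>T\<close> centralizes
  \<open>k\<close>, the order also divides the \<open>T\<close>-class size of \<open>x\<close> and
  hence its full class size.\<close>

lemma X1_commute:
  assumes x: "x \<in> X1" and t: "t \<in> X1"
  shows "x \<otimes> t = t \<otimes> x"
proof -
  have xc: "x \<in> carrier G" and tc: "t \<in> carrier G" using x t part_carrier by auto
  define k where "k = conjugate x t \<otimes> inv x"
  define T where "T = {g \<in> carrier G. \<forall>k\<in>stab. g \<otimes> k = k \<otimes> g}"
  have k: "k \<in> stab" using commutator_in_stab[OF inv_X1[OF x] tc] xc by (simp add: k_def)
  have kc: "k \<in> carrier G" using k stab_carrier by blast
  have T: "subgroup T G"
  proof (rule subgroupI)
    show "T \<subseteq> carrier G" unfolding T_def by blast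
    have "\<one> \<in> T" unfolding T_def using stab_carrier by simp
    then show "T \<noteq> {}" by blast
    show "inv a \<in> T" if "a \<in> T" for a
      using that stab_carrier commute_inv unfolding T_def by simp
    show "a \<otimes> b \<in> T" if "a \<in> T" "b \<in> T" for a b
      using that stab_carrier commute_mult unfolding T_def by simp
  qed
  have inv_T: "conjugate a g \<in> T" if a: "a \<in> T" and g: "g \<in> carrier G" for a g
  proof -
    have ac: "a \<in> carrier G" using a unfolding T_def by blast
    have "conjugate a g \<otimes> l = l \<otimes> conjugate a g" if l: "l \<in> stab" for l
    proof -
      have lc: "l \<in> carrier G" using l stab_carrier by blast
      have "a \<otimes> conjugate l (inv g) = conjugate l (inv g) \<otimes> a"
        using a conjugate_stab[OF l inv_closed[OF g]] unfolding T_def by blast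
      then have "conjugate (a \<otimes> conjugate l (inv g)) g = conjugate (conjugate l (inv g) \<otimes> a) g" by simp
      then show ?thesis using ac lc g by (simp add: conjugate_mult conjugate_conjugate)
    qed
    then show ?thesis unfolding T_def using ac g by simp
  qed
  have tT: "t \<in> T" unfolding T_def using tc stab_centralizes_X1[OF t] by simp
  have "conjugate x t = k \<otimes> x" using xc tc by (simp add: k_def m_assoc)
  then have "ord k dvd card (class_in T x)"
    using ord_commutator_dvd_class_in[OF fin T xc kc tT] k unfolding T_def by blast
  also have "\<dots> dvd csize x"
    using card_class_in_normal_dvd[OF carrier_group T subgroup.subset[OF T] inv_T xc] .
  finally have "ord k dvd csize x" .
  moreover have "ord k dvd card stab"
    using subgroup.m_closed[OF stab_subgroup k]
    by (intro ord_dvd_stable[OF fin kc subgroup.subset[OF stab_subgroup]]) blast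
  then have "ord k dvd csize b0" using card_stab_dvd dvd_trans by blast
  ultimately have "ord k = 1" using csize_coprime_dvd[OF x b0] by blast
  then have "k = \<one>" using ord_eq_1[OF kc] by blast
  then have "conjugate x t = x" using \<open>conjugate x t = k \<otimes> x\<close> xc by simp
  then show ?thesis using conjugate_eq_self_iff[OF xc tc] by simp
qed

end

section \<open>Passing to subgroups, and \<open>p\<close>-groups modulo central subgroups\<close>

lemma (in group) comm_group_subgroup:
  assumes "subgroup S G" "\<And>s t. s \<in> S \<Longrightarrow> t \<in> S \<Longrightarrow> s \<otimes> t = t \<otimes> s"
  shows "comm_group (G\<lparr>carrier := S\<rparr>)"
  using group.group_comm_groupI[OF subgroup_imp_group[OF assms(1)]] assms(2) by simp

lemma (in group) normal_in_subgroupI: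
  assumes S: "subgroup S G" and T: "subgroup T G" and sub: "S \<subseteq> T"
    and conjugate: "\<And>s t. s \<in> S \<Longrightarrow> t \<in> T \<Longrightarrow> conjugate s t \<in> S"
  shows "S \<lhd> G\<lparr>carrier := T\<rparr>"
proof -
  interpret H: group "G\<lparr>carrier := T\<rparr>" using T by (rule subgroup_imp_group)
  show ?thesis
  proof (rule H.normal_invI)
    show "subgroup S (G\<lparr>carrier := T\<rparr>)" using subgroup_incl[OF S T sub] .
    fix x h assume x: "x \<in> carrier (G\<lparr>carrier := T\<rparr>)" and h: "h \<in> S"
    then have xT: "x \<in> T" by simp
    then have "conjugate h (inv x) \<in> S" using conjugate[OF h] subgroup.m_inv_closed[OF T] by blast
    then show "x \<otimes>\<^bsub>G\<lparr>carrier := T\<rparr>\<^esub> h \<otimes>\<^bsub>G\<lparr>carrier := T\<rparr>\<^esub> inv\<^bsub>G\<lparr>carrier := T\<rparr>\<^esub> x \<in> S"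
      using xT T subgroup.mem_carrier[OF T xT] by (simp add: conjugate_def)
  qed
qed

text \<open>The centralizer is assumed normal in \<open>T\<close>, and the factor group has the
  class size as its order.\<close>

lemma (in group) pow_card_class_in_in_centralizer_in:
  assumes T: "subgroup T G" "finite T" and x: "x \<in> carrier G"
    and conjugate: "\<And>s t. s \<in> centralizer_in T x \<Longrightarrow> t \<in> T \<Longrightarrow> conjugate s t \<in> centralizer_in T x" and t: "t \<in> T"
  shows "t [^] card (class_in T x) \<in> centralizer_in T x"
proof -
  interpret H: group "G\<lparr>carrier := T\<rparr>" using T(1) by (rule subgroup_imp_group)
  interpret S: normal "centralizer_in T x" "G\<lparr>carrier := T\<rparr>"
    using normal_in_subgroupI[OF centralizer_in_subgroup[OF T(1) x] T(1) centralizer_in_subset conjugate] .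
  have pos: "card (centralizer_in T x) > 0"
    using finite_subset[OF centralizer_in_subset T(2)] subgroup.one_closed[OF centralizer_in_subgroup[OF T(1) x]]
    by (metis card_gt_0_iff empty_iff)
  have "card (rcosets\<^bsub>G\<lparr>carrier := T\<rparr>\<^esub> (centralizer_in T x)) * card (centralizer_in T x) = card (class_in T x) * card (centralizer_in T x)"
    using H.lagrange[OF S.subgroup_axioms] card_class_in_mult_centralizer_in[OF T x] by (simp add: order_def)
  then have "card (rcosets\<^bsub>G\<lparr>carrier := T\<rparr>\<^esub> (centralizer_in T x)) = card (class_in T x)"
    using pos by simp
  then show ?thesis using S.pow_card_rcosets_mem[of t] t by (simp flip: nat_pow_consistent)
qed

text \<open>The factor group of \<open>R\<close> by \<open>A\<close> has exponent dividing a power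
  of \<open>p\<close>, so by Cauchy's theorem its order has no other prime divisor.\<close>

lemma (in group) card_eq_prime_power_mult:
  assumes fin: "finite (carrier G)" and R: "subgroup R G" and A: "subgroup A G" "A \<subseteq> R"
    and conjugate: "\<And>a r. a \<in> A \<Longrightarrow> r \<in> R \<Longrightarrow> conjugate a r \<in> A" and p: "prime p"
    and exp: "\<And>r. r \<in> R \<Longrightarrow> r [^] (p ^ k :: nat) \<in> A"
  obtains e where "card R = p ^ e * card A"
proof -
  interpret H: group "G\<lparr>carrier := R\<rparr>" using R by (rule subgroup_imp_group)
  interpret A: normal A "G\<lparr>carrier := R\<rparr>" using normal_in_subgroupI[OF A(1) R A(2) conjugate] .
  let ?I = "rcosets\<^bsub>G\<lparr>carrier := R\<rparr>\<^esub> A"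
  have finR: "finite R" using finite_subset[OF subgroup.subset[OF R] fin] .
  have lag: "card ?I * card A = card R"
    using H.lagrange[OF A.subgroup_axioms] by (simp add: order_def)
  have "card R > 0" using finR subgroup.one_closed[OF R] by (metis card_gt_0_iff empty_iff)
  then have "card ?I > 0" using lag by (metis mult_is_0 neq0_conv)
  moreover have "q = p" if q: "prime q" "q dvd card ?I" for q
  proof -
    have "q dvd p ^ k"
      using A.prime_dvd_card_rcosets_imp_dvd_exponent[of q "p ^ k"] q finR exp
      by (simp flip: nat_pow_consistent)
    then show ?thesis using q(1) p by (metis prime_dvd_power primes_dvd_imp_eq)
  qed
  ultimately obtain e where "card ?I = p ^ e"
    using only_prime_divisor_imp_power[of "card ?I" p] p by blast
  then show thesis using that lag by metis
qed

text \<open>\<open>A\<close> collects the elements of \<open>N \<inter> Z(G)\<close> of order prime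
  to \<open>p\<close>. Its index in \<open>N\<close> is a power of \<open>p\<close>, so a subgroup
  \<open>P\<close> of that order meets \<open>A\<close> trivially and \<open>P A\<close> has the
  size of \<open>N\<close>.\<close>

lemma (in group) p_group_times_central:
  assumes fin: "finite (carrier G)" and N: "subgroup N G" and p: "prime p"
    and exp: "\<And>n. n \<in> N \<Longrightarrow> n [^] (p ^ k :: nat) \<in> center G"
  shows "\<exists>P A. internal_direct_product (G\<lparr>carrier := N\<rparr>) P A \<and>
    p_group p (G\<lparr>carrier := P\<rparr>) \<and> A \<subseteq> center G"
proof -
  interpret N: subgroup N G by (rule N)
  interpret H: group "G\<lparr>carrier := N\<rparr>" using N by (rule subgroup_imp_group)
  define A where "A = {z \<in> N. z \<in> center G \<and> coprime (ord z) p}"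
  have AN: "A \<subseteq> N" and Ac: "A \<subseteq> center G" unfolding A_def by blast+
  have A_carrier: "a \<in> carrier G" if "a \<in> A" for a using that AN N.subset by blast
  have A_comm: "a \<otimes> g = g \<otimes> a" if "a \<in> A" "g \<in> carrier G" for a g
    using center_commute Ac that by blast
  have A: "subgroup A G"
  proof (rule subgroupI)
    show "A \<subseteq> carrier G" using A_carrier by blast
    have "\<one> \<in> A" unfolding A_def using subgroup.one_closed[OF center_subgroup] by simp
    then show "A \<noteq> {}" by blast
    show "inv a \<in> A" if "a \<in> A" for a
      using that A_carrier[OF that] subgroup.m_inv_closed[OF center_subgroup, of a]
      unfolding A_def by (simp add: ord_inv)
    show "a \<otimes> b \<in> A" if ab: "a \<in> A" "b \<in> A" for a b
    proof -
      have c: "a \<in> carrier G" "b \<in> carrier G" using ab A_carrier by auto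
      have "(a \<otimes> b) [^] (ord a * ord b) = a [^] (ord a * ord b) \<otimes> b [^] (ord b * ord a)"
        using pow_mult_distrib[OF A_comm[OF ab(1) c(2)] c] by (simp add: mult.commute)
      also have "\<dots> = \<one>" using c by (simp flip: nat_pow_pow)
      finally have "ord (a \<otimes> b) dvd ord a * ord b" using c by (simp add: pow_eq_id)
      moreover have "coprime (ord a * ord b) p" using ab unfolding A_def by simp
      ultimately have "coprime (ord (a \<otimes> b)) p" by (meson coprime_divisors dvd_refl)
      moreover have "a \<otimes> b \<in> N" "a \<otimes> b \<in> center G"
        using ab subgroup.m_closed[OF center_subgroup, of a b] unfolding A_def by auto
      ultimately show ?thesis unfolding A_def by blast
    qed
  qed
  have A_conjugate: "conjugate a g \<in> A" if "a \<in> A" "g \<in> carrier G" for a g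
  proof -
    have "conjugate a g = a" using A_comm[OF that] conjugate_eq_self_iff[OF A_carrier[OF that(1)] that(2)] by simp
    then show ?thesis using that by simp
  qed
  \<comment> \<open>The factor \<open>p^k\<close> moves \<open>n\<close> into the centre; the
    further factor \<open>p ^ order G\<close> makes the order prime to \<open>p\<close>.\<close>
  have expA: "n [^] (p ^ (k + order G)) \<in> A" if n: "n \<in> N" for n
  proof -
    have nc: "n \<in> carrier G" using n by simp
    have eq: "n [^] (p ^ (k + order G)) = (n [^] (p ^ k)) [^] (p ^ order G)"
      using nc by (simp add: nat_pow_pow power_add)
    have "n [^] (p ^ (k + order G)) \<in> N" using subgroup_pow_closed[OF N n] .
    moreover have "n [^] (p ^ (k + order G)) \<in> center G"
      unfolding eq using subgroup_pow_closed[OF center_subgroup exp[OF n]] .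
    moreover have "coprime (ord (n [^] (p ^ (k + order G)))) p"
      unfolding eq using coprime_ord_pow_order[OF fin] nc by simp
    ultimately show ?thesis unfolding A_def by blast
  qed
  obtain c where c: "card N = p ^ c * card A"
    using card_eq_prime_power_mult[OF fin N A AN A_conjugate p expA] N.mem_carrier by blast
  have finN: "finite N" using finite_subset[OF N.subset fin] .
  obtain P where P: "subgroup P (G\<lparr>carrier := N\<rparr>)" "card P = p ^ c"
    using sylow_thm[OF p H.group_axioms, of c "card A"] c finN by (auto simp: order_def)
  have PN: "P \<subseteq> N" using subgroup.subset[OF P(1)] by simp
  have PG: "subgroup P G" using incl_subgroup[OF N P(1)] .
  interpret P: subgroup P G by (rule PG)
  interpret A: subgroup A G by (rule A)
  have PA: "P \<inter> A = {\<one>}"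
  proof (intro equalityI subsetI)
    fix x assume x: "x \<in> P \<inter> A"
    then have xc: "x \<in> carrier G" by auto
    interpret GP: group "G\<lparr>carrier := P\<rparr>" using PG by (rule subgroup_imp_group)
    have "x [^] (p ^ c) = \<one>"
      using GP.pow_order_eq_1[of x] x P(2) by (simp add: order_def flip: nat_pow_consistent)
    moreover have "x [^] ord x = \<one>" using xc by simp
    moreover have "coprime (p ^ c) (ord x)" using x unfolding A_def by (simp add: coprime_commute)
    ultimately show "x \<in> {\<one>}" using pow_coprime_eq_one[OF xc] by blast
  qed auto
  have "inj_on (\<lambda>(x, a). x \<otimes> a) (P \<times> A)"
  proof (rule inj_onI, clarsimp)
    fix x a y b assume xa: "x \<in> P" "a \<in> A" "y \<in> P" "b \<in> A" and eq: "x \<otimes> a = y \<otimes> b"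
    have cs: "x \<in> carrier G" "a \<in> carrier G" "y \<in> carrier G" "b \<in> carrier G" using xa by auto
    have "inv y \<otimes> x = inv y \<otimes> (x \<otimes> a) \<otimes> inv a" using cs by (simp add: m_assoc)
    also have "\<dots> = b \<otimes> inv a" unfolding eq using cs by simp
    finally have e: "inv y \<otimes> x = b \<otimes> inv a" .
    then have "inv y \<otimes> x \<in> P \<inter> A" using xa P.m_closed A.m_closed P.m_inv_closed A.m_inv_closed by (metis IntI)
    then have 1: "inv y \<otimes> x = \<one>" "b \<otimes> inv a = \<one>" using PA e by auto
    have "x = y \<otimes> (inv y \<otimes> x)" "b = b \<otimes> inv a \<otimes> a" using cs by (simp_all add: m_assoc)
    then show "x = y \<and> a = b" unfolding 1 using cs by simp
  qed
  then have "card ((\<lambda>(x, a). x \<otimes> a) ` (P \<times> A)) = card N"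
    using P(2) c by (simp add: card_image card_cartesian_product)
  moreover have "(\<lambda>(x, a). x \<otimes> a) ` (P \<times> A) \<subseteq> N" using PN AN by auto
  ultimately have img: "(\<lambda>(x, a). x \<otimes> a) ` (P \<times> A) = N"
    using card_subset_eq[OF finN] by blast
  \<comment> \<open>In \<open>n = x a\<close> the factor \<open>a\<close> is central, so
    \<open>n\<close> acts on \<open>P\<close> like the element \<open>x\<close> of
    \<open>P\<close>.\<close>
  have P_conjugate: "conjugate h n \<in> P" if h: "h \<in> P" and n: "n \<in> N" for h n
  proof -
    obtain x a where xa: "x \<in> P" "a \<in> A" "n = x \<otimes> a" using n unfolding img[symmetric] by auto
    have "conjugate h n = conjugate (conjugate h x) a" using xa h by (simp add: conjugate_conjugate)
    also have "\<dots> = conjugate h x"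
      using A_comm[OF xa(2), of "conjugate h x"] xa h by (simp add: conjugate_eq_self_iff)
    finally show ?thesis using xa h by (simp add: conjugate_def)
  qed
  have "P \<lhd> G\<lparr>carrier := N\<rparr>" "A \<lhd> G\<lparr>carrier := N\<rparr>"
    using normal_in_subgroupI[OF PG N PN P_conjugate] normal_in_subgroupI[OF A N AN A_conjugate] by auto
  moreover have "P <#>\<^bsub>G\<lparr>carrier := N\<rparr>\<^esub> A = N"
    using img by (auto simp: set_mult_def)
  ultimately have "internal_direct_product (G\<lparr>carrier := N\<rparr>) P A"
    using PA unfolding internal_direct_product_def by simp
  moreover have "p_group p (G\<lparr>carrier := P\<rparr>)"
    using p P(2) subgroup_imp_group[OF PG] unfolding p_group_def by (auto simp: order_def)
  ultimately show ?thesis using Ac by blast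
qed

section \<open>Commuting elements across the parts, and reduction to the criterion\<close>

context coprime_class_partition
begin

lemma central_in_centralizer_in: "z \<in> N \<Longrightarrow> z \<in> center G \<Longrightarrow> x \<in> carrier G \<Longrightarrow> z \<in> centralizer_in N x"
  unfolding centralizer_in_def using center_commute by blast

text \<open>By coprimality of the orders, what commutes with \<open>x y\<close> commutes with
  \<open>x\<close> and with \<open>y\<close>. The class size of \<open>x y\<close> is then a
  multiple of both class sizes, so \<open>x y\<close> fits into neither part.\<close>

lemma not_commute_coprime:
  assumes x: "x \<in> X1" and y: "y \<in> X2" and xy: "x \<otimes> y = y \<otimes> x" and cop: "coprime (ord x) (ord y)"
  shows False
proof -
  have xc: "x \<in> carrier G" and yc: "y \<in> carrier G" using x y part_carrier by auto
  have cx: "centralizer_in (carrier G) (x \<otimes> y) \<subseteq> centralizer_in (carrier G) x"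
    using commute_of_commute_mult_coprime[OF xc yc _ xy cop] unfolding centralizer_in_def by auto
  have cy: "centralizer_in (carrier G) (x \<otimes> y) \<subseteq> centralizer_in (carrier G) y"
    using commute_of_commute_mult_coprime[OF yc xc _ xy[symmetric]] cop xy
    unfolding centralizer_in_def by (auto simp: coprime_commute)
  have dx: "csize x dvd csize (x \<otimes> y)" and dy: "csize y dvd csize (x \<otimes> y)"
    using card_class_in_dvd_of_centralizer_in_subset[OF carrier_group _ xc cx]
      card_class_in_dvd_of_centralizer_in_subset[OF carrier_group _ yc cy] xc yc by auto
  have "x \<otimes> y \<notin> center G"
  proof
    assume "x \<otimes> y \<in> center G"
    then have "g \<in> centralizer_in (carrier G) x" if "g \<in> carrier G" for g
      using cx that center_commute[of "x \<otimes> y" g] unfolding centralizer_in_def by auto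
    then have "x \<in> center G" using centerI[OF xc] unfolding centralizer_in_def by blast
    then show False using part_noncentral x by blast
  qed
  then consider "x \<otimes> y \<in> X1" | "x \<otimes> y \<in> X2"
    using part_cases[of "x \<otimes> y"] N.m_closed part_subset x y by blast
  then show False
  proof cases
    case 1
    then show False
      using csize_coprime_dvd[OF 1 y dy dvd_refl] csize_neq_1[OF yc] part_noncentral(2)[OF y] by blast
  next
    case 2
    then show False
      using csize_coprime_dvd[OF x 2 dvd_refl dx] csize_neq_1[OF xc] part_noncentral(1)[OF x] by blast
  qed
qed

text \<open>The criterion is applied inside \<open>N\<close> with \<open>S\<close> the centralizer
  of \<open>x0\<close>. Its factorization hypothesis comes from the coprime \<open>N\<close>-class
  sizes of \<open>x0\<close> and of an outside element. The centre is that of \<open>N\<close>,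
  which is why \<open>central\<close> concludes commutation with every \<open>n\<close> in
  \<open>N\<close>.\<close>

lemma quasi_frobenius_of_abelian_centralizer_in:
  assumes x0: "x0 \<in> X1" and comm: "\<And>s t. s \<in> centralizer_in N x0 \<Longrightarrow> t \<in> centralizer_in N x0 \<Longrightarrow> s \<otimes> t = t \<otimes> s"
    and conjugate: "\<And>s n. s \<in> centralizer_in N x0 \<Longrightarrow> n \<in> N \<Longrightarrow> conjugate s n \<in> centralizer_in N x0"
    and y0: "y0 \<in> N" "y0 \<notin> centralizer_in N x0"
    and outside: "\<And>y. y \<in> N \<Longrightarrow> y \<notin> centralizer_in N x0 \<Longrightarrow> y \<in> X2"
    and central: "\<And>y s n. y \<in> N \<Longrightarrow> y \<notin> centralizer_in N x0 \<Longrightarrow> s \<in> centralizer_in N x0 \<Longrightarrow> y \<otimes> s = s \<otimes> y \<Longrightarrow>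
      n \<in> N \<Longrightarrow> s \<otimes> n = n \<otimes> s"
  shows "quasi_frobenius (G\<lparr>carrier := N\<rparr>) \<and>
    (\<exists>K L. quasi_frobenius_kernel_complement (G\<lparr>carrier := N\<rparr>) K L \<and>
      comm_group (G\<lparr>carrier := K\<rparr>) \<and> comm_group (G\<lparr>carrier := L\<rparr>))"
proof -
  let ?H = "G\<lparr>carrier := N\<rparr>"
  define S where "S = centralizer_in N x0"
  have xc: "x0 \<in> carrier G" using x0 part_carrier by blast
  have S: "subgroup S G" unfolding S_def using centralizer_in_subgroup[OF N.subgroup_axioms xc] .
  have SN: "S \<subseteq> N" unfolding S_def by (rule centralizer_in_subset)
  interpret H: group ?H using N.subgroup_axioms by (rule subgroup_imp_group)
  have nS: "S \<lhd> ?H" using normal_in_subgroupI[OF S N.subgroup_axioms SN] conjugate unfolding S_def by blast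
  have Hcent: "H.centralizer_in T x = centralizer_in T x" for T x unfolding H.centralizer_in_def centralizer_in_def by simp
  have Hcj: "H.conjugate x n = conjugate x n" if "n \<in> N" for x n
    using that N.subgroup_axioms unfolding H.conjugate_def conjugate_def by simp
  have Hcenter: "center ?H = {z \<in> N. \<forall>g\<in>N. z \<otimes> g = g \<otimes> z}" unfolding center_def by simp
  have c1: "finite (carrier ?H)" using finite_N by simp
  have c2: "s \<otimes>\<^bsub>?H\<^esub> t = t \<otimes>\<^bsub>?H\<^esub> s" if "s \<in> S" "t \<in> S" for s t
    using comm that unfolding S_def by simp
  have y0S: "y0 \<in> carrier ?H" "y0 \<notin> S" using y0 unfolding S_def by auto
  have x0S: "x0 \<in> S" unfolding S_def centralizer_in_def using x0 part_subset by blast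
  have x0n: "x0 \<notin> center ?H"
  proof
    assume "x0 \<in> center ?H"
    then have "x0 \<otimes> y0 = y0 \<otimes> x0" using y0 unfolding Hcenter by blast
    then show False using y0 unfolding centralizer_in_def by simp
  qed
  have c3: "s \<in> center ?H"
    if "x \<in> carrier ?H" "x \<notin> S" "s \<in> S" "x \<otimes>\<^bsub>?H\<^esub> s = s \<otimes>\<^bsub>?H\<^esub> x" for x s
  proof -
    have "s \<otimes> n = n \<otimes> s" if "n \<in> N" for n
      using central[of x s n] \<open>x \<in> carrier ?H\<close> \<open>x \<notin> S\<close> \<open>s \<in> S\<close> \<open>x \<otimes>\<^bsub>?H\<^esub> s = _\<close> that
      unfolding S_def by simp
    then show ?thesis using \<open>s \<in> S\<close> SN unfolding Hcenter by blast
  qed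
  have cop: "coprime (card (class_in N x0)) (card (class_in N x))" if "x \<in> N" "x \<notin> S" for x
    using coprime_nsize[OF x0] outside that unfolding S_def by blast
  have c4: "\<exists>c\<in>H.centralizer_in (carrier ?H) x. \<exists>s\<in>S. h = c \<otimes>\<^bsub>?H\<^esub> s"
    if x: "x \<in> carrier ?H" "x \<notin> S" and h: "h \<in> carrier ?H" for x h
  proof -
    have x': "x \<in> N" "x \<in> carrier G" using x by auto
    obtain c s where "c \<in> centralizer_in N x" "s \<in> centralizer_in N x0" "h = c \<otimes> s"
      using coprime_class_in_decompose[OF N_group xc x'(2) cop[OF x'(1) x(2)], of h] h by auto
    then show ?thesis unfolding Hcent S_def by auto
  qed
  \<comment> \<open>The order of \<open>z\<close> divides two coprime numbers: the
    \<open>N\<close>-class size of \<open>x\<close>, since \<open>S\<close> centralizes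
    \<open>z\<close>, and the \<open>N\<close>-class size of \<open>x0\<close>, since
    \<open>x\<close> raised to that index lies in the abelian group \<open>S\<close> and commutes
    with \<open>s\<close>.\<close>
  have c5: "z = \<one>\<^bsub>?H\<^esub>"
    if x: "x \<in> carrier ?H" "x \<notin> S" and s: "s \<in> S" and z: "z \<in> center ?H"
      and eq: "H.conjugate x s = x \<otimes>\<^bsub>?H\<^esub> z" for x s z
  proof -
    have x': "x \<in> N" "x \<in> carrier G" using x by auto
    have sN: "s \<in> N" "s \<in> carrier G" using s SN by auto
    have z': "z \<in> N" "\<And>g. g \<in> N \<Longrightarrow> z \<otimes> g = g \<otimes> z" using z unfolding Hcenter by auto
    have zc: "z \<in> carrier G" using z' by simp
    have eq': "conjugate x s = x \<otimes> z" using eq Hcj[OF sN(1)] by simp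
    have "ord z dvd card (class_in S x)"
      by (rule ord_commutator_dvd_class_in[OF fin S x'(2) zc s]) (use eq' z'(2) x' SN in auto)
    also have "\<dots> dvd card (class_in N x)"
      using card_class_in_normal_dvd[OF N_group S SN _ x'(2)] conjugate unfolding S_def by blast
    finally have d1: "ord z dvd card (class_in N x)" .
    have "x [^] card (class_in N x0) \<in> S"
      using pow_card_class_in_in_centralizer_in[OF N_group xc conjugate x'(1)] unfolding S_def by blast
    then have "s \<otimes> x [^] card (class_in N x0) = x [^] card (class_in N x0) \<otimes> s"
      using comm s unfolding S_def by blast
    then have "z [^] card (class_in N x0) = \<one>"
      using commutator_pow_eq_one[OF x'(2) sN(2) zc eq' z'(2)[OF x'(1), symmetric]] by blast
    then have d2: "ord z dvd card (class_in N x0)" using zc by (simp add: pow_eq_id)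
    have "ord z = 1" using cop[OF x'(1) x(2)] d1 d2 by (meson coprime_common_divisor_nat)
    then show ?thesis using ord_eq_1[OF zc] by simp
  qed
  define L where "L = H.centralizer_in (carrier ?H) y0"
  have q: "quasi_frobenius_kernel_complement ?H S L"
    unfolding L_def by (rule H.quasi_frobenius_criterion(1)[OF c1 nS c2 y0S x0S x0n c3 c4 c5])
  have LL: "l \<otimes> l' = l' \<otimes> l" if "l \<in> L" "l' \<in> L" for l l'
  proof -
    have "l \<otimes>\<^bsub>?H\<^esub> l' = l' \<otimes>\<^bsub>?H\<^esub> l"
      by (rule H.quasi_frobenius_criterion(2)[OF c1 nS c2 y0S x0S x0n c3 c4 c5 that[unfolded L_def]])
    then show ?thesis by simp
  qed
  have "subgroup L G"
    using centralizer_in_subgroup[OF N.subgroup_axioms] y0 unfolding L_def Hcent by simp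
  then have "comm_group (G\<lparr>carrier := L\<rparr>)" using comm_group_subgroup LL by blast
  moreover have "comm_group (G\<lparr>carrier := S\<rparr>)"
    using comm_group_subgroup[OF S] comm unfolding S_def by blast
  ultimately show ?thesis using q unfolding quasi_frobenius_kernel_complement_def by blast
qed

end

section \<open>The structure of the normal subgroup\<close>

context coprime_class_partition
begin

abbreviation quasi_frobenius_alternative :: bool where
  "quasi_frobenius_alternative \<equiv> quasi_frobenius (G\<lparr>carrier := N\<rparr>) \<and>
    (\<exists>K L. quasi_frobenius_kernel_complement (G\<lparr>carrier := N\<rparr>) K L \<and>
      comm_group (G\<lparr>carrier := K\<rparr>) \<and> comm_group (G\<lparr>carrier := L\<rparr>))"

lemma X1_in_centralizer_in: "x \<in> X1 \<Longrightarrow> y \<in> X1 \<Longrightarrow> y \<in> centralizer_in N x"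
  unfolding centralizer_in_def using X1_commute part_subset by blast

lemma centralizer_in_N_subgroup: "x \<in> carrier G \<Longrightarrow> subgroup (centralizer_in N x) G"
  using centralizer_in_subgroup[OF N.subgroup_axioms] .

text \<open>All elements of \<open>S\<close> are central in \<open>G\<close> or in
  \<open>X1\<close>, which gives commutativity and normality at once. The remaining hypothesis
  \<open>central\<close> is proved by splitting off the part of \<open>s\<close> whose order is
  prime to the index \<open>n0\<close> of \<open>S\<close>.\<close>

lemma alternative_if_centralizer_in_avoids_X2:
  assumes x0: "x0 \<in> X1" and avoid: "\<And>y. y \<in> centralizer_in N x0 \<Longrightarrow> y \<notin> X2"
  shows quasi_frobenius_alternative
proof -
  define S where "S = centralizer_in N x0"
  define n0 where "n0 = card (class_in N x0)"
  have xc: "x0 \<in> carrier G" using x0 part_carrier by blast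
  have S: "subgroup S G" unfolding S_def using centralizer_in_N_subgroup[OF xc] .
  interpret S: subgroup S G by (rule S)
  have SN: "S \<subseteq> N" unfolding S_def by (rule centralizer_in_subset)
  have S_cases: "s \<in> X1 \<or> s \<in> center G" if "s \<in> S" for s
    using that part_cases[of s] SN avoid[of s] unfolding S_def by blast
  have comm: "s \<otimes> t = t \<otimes> s" if "s \<in> S" "t \<in> S" for s t
    using S_cases[OF that(1)] S_cases[OF that(2)] X1_commute[of s t]
      center_commute[of s t] center_commute[of t s] S.mem_carrier[OF that(1)] S.mem_carrier[OF that(2)] by metis
  have conjugate: "conjugate s n \<in> S" if s: "s \<in> S" and n: "n \<in> N" for s n
  proof (cases "s \<in> X1")
    case True
    then show ?thesis unfolding S_def using X1_in_centralizer_in[OF x0] conjugate_X1 n by simp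
  next
    case False
    then show ?thesis using S_cases[OF s] conjugate_center s n by simp
  qed
  have outside: "y \<in> X2" if "y \<in> N" "y \<notin> S" for y
    using that part_cases[of y] X1_in_centralizer_in[OF x0, of y] central_in_centralizer_in[OF that(1) _ xc]
    unfolding S_def by blast
  have b0N: "b0 \<in> N" "b0 \<notin> S" using b0 part_subset avoid unfolding S_def by blast+
  have central: "s \<otimes> n = n \<otimes> s"
    if y: "y \<in> N" "y \<notin> S" and s: "s \<in> S" and ys: "y \<otimes> s = s \<otimes> y" and n: "n \<in> N" for y s n
  proof -
    have sc: "s \<in> carrier G" and yc: "y \<in> carrier G" and nc: "n \<in> carrier G" using s y n by auto
    define m where "m = n0 ^ order G"
    define s2 where "s2 = s [^] m"
    have s2S: "s2 \<in> S" unfolding s2_def using subgroup_pow_closed[OF S s] .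
    have cop2: "coprime (ord s2) n0"
      unfolding s2_def m_def using coprime_ord_pow_order[OF fin sc] .
    have s2Z: "s2 \<in> center G"
    proof (rule ccontr)
      assume "s2 \<notin> center G"
      then have s2X: "s2 \<in> X1" using S_cases[OF s2S] by blast
      \<comment> \<open>\<open>y^M\<close> has order prime to \<open>ord s2\<close>. It stays
        outside \<open>S\<close>, since \<open>y^n0\<close> is in \<open>S\<close>, \<open>M\<close>
        is prime to \<open>n0\<close>, and \<open>y\<close> is not in \<open>S\<close>. So
        \<open>s2\<close> in \<open>X1\<close> and \<open>y^M\<close> in \<open>X2\<close> would be
        commuting elements of coprime orders.\<close>
      define M where "M = ord s2 ^ order G"
      have copM: "coprime (ord (y [^] M)) (ord s2)"
        unfolding M_def using coprime_ord_pow_order[OF fin yc] .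
      have "y [^] n0 \<in> S"
        unfolding S_def n0_def using pow_card_class_in_in_centralizer_in[OF N_group xc _ y(1)] conjugate unfolding S_def by blast
      moreover have "coprime M n0" unfolding M_def using cop2 by simp
      ultimately have "y [^] M \<notin> S" using subgroup_mem_coprime_pow[OF S yc] y(2) by blast
      then have yX: "y [^] M \<in> X2" using outside pow_in_N[OF y(1)] by blast
      have "y [^] M \<otimes> s = s \<otimes> y [^] M" using commute_pow[OF yc sc ys] .
      then have "s2 \<otimes> y [^] M = y [^] M \<otimes> s2"
        unfolding s2_def using commute_pow[OF sc, of "y [^] M"] yc by simp
      then show False using not_commute_coprime[OF s2X yX] copM by (simp add: coprime_commute)
    qed
    show ?thesis
    proof (cases "n \<in> S")
      case True
      then show ?thesis using comm s by blast
    next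
      case False
      \<comment> \<open>\<open>k\<close> measures the failure of \<open>s\<close> and
        \<open>n\<close> to commute. Its \<open>m\<close>-th power is trivial because
        \<open>s^m\<close> is central, and its order also divides the \<open>N\<close>-class size of
        \<open>n\<close>, which is prime to \<open>n0\<close> and so to \<open>m\<close>.\<close>
      define k where "k = inv s \<otimes> conjugate s (inv n)"
      have kS: "k \<in> S" unfolding k_def using s n conjugate by simp
      have kc: "k \<in> carrier G" using kS by simp
      have eq: "conjugate n s = k \<otimes> n" unfolding k_def using sc nc by (simp add: conjugate_def m_assoc)
      have "ord k dvd card (class_in S n)"
        using ord_commutator_dvd_class_in[OF fin S nc kc s eq] comm kS by blast
      also have "\<dots> dvd card (class_in N n)"
        using card_class_in_normal_dvd[OF N_group S SN conjugate nc] .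
      finally have d1: "ord k dvd card (class_in N n)" .
      have "conjugate s (inv n) \<in> S" using conjugate s n by simp
      then have "inv s \<otimes> conjugate s (inv n) = conjugate s (inv n) \<otimes> inv s" using comm s by simp
      then have "k [^] m = inv s [^] m \<otimes> conjugate s (inv n) [^] m"
        unfolding k_def using sc nc by (intro pow_mult_distrib) auto
      also have "\<dots> = inv s2 \<otimes> conjugate s2 (inv n)"
        unfolding s2_def using sc nc by (simp add: conjugate_pow nat_pow_inv)
      also have "\<dots> = \<one>" using conjugate_center[OF s2Z, of "inv n"] nc s2S by simp
      finally have "ord k dvd m" using kc by (simp add: pow_eq_id)
      moreover have "coprime m (card (class_in N n))"
        unfolding m_def n0_def using coprime_nsize[OF x0 outside[OF n False]] by simp
      ultimately have "ord k = 1" using d1 by (meson coprime_common_divisor_nat)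
      then have "k = \<one>" using ord_eq_1[OF kc] by simp
      then have "conjugate n s = n" using eq nc by simp
      then show ?thesis using conjugate_eq_self_iff[OF nc sc] by simp
    qed
  qed
  show ?thesis
    using quasi_frobenius_of_abelian_centralizer_in[OF x0, folded S_def, OF comm conjugate b0N outside central] .
qed

text \<open>The element \<open>y0 = y^P\<close> of order prime to \<open>p\<close> cannot lie in any
  \<open>C_N(x)\<close> with \<open>x\<close> in \<open>X1\<close>, as those are
  \<open>p\<close>-groups modulo the centre. This makes \<open>p\<close> divide the class size of
  \<open>y0\<close>, hence not that of \<open>x\<close>, which is the source of normality arguments
  modulo \<open>C_N(x)\<close>.\<close>

lemma alternative_if_p'_element:
  fixes p :: nat
  defines "P \<equiv> p ^ order G"
  assumes p: "prime p"
    and pow_central: "\<And>x c. x \<in> X1 \<Longrightarrow> c \<in> centralizer_in N x \<Longrightarrow> c [^] P \<in> center G"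
    and y: "y \<in> X2" "y [^] P \<notin> center G"
  shows quasi_frobenius_alternative
proof -
  let ?Z = "N \<inter> center G"
  have Z: "subgroup ?Z G" using subgroups_Inter_pair[OF N.subgroup_axioms center_subgroup] .
  define y0 where "y0 = y [^] P"
  have y0X: "y0 \<in> X2" unfolding y0_def using pow_X2 y by blast
  have y0c: "y0 \<in> carrier G" using y0X part_carrier by blast
  have y0n: "y0 \<notin> center G" using y0X part_noncentral by blast
  have y0_ord: "coprime (ord y0) p"
    unfolding y0_def P_def using coprime_ord_pow_order[OF fin] part_carrier(2)[OF y(1)] .
  have P_ord: "coprime P (ord y0)"
    unfolding P_def using y0_ord by (simp add: coprime_commute)
  have y0_centralizer_in: "y0 \<notin> centralizer_in N x" if x: "x \<in> X1" for x
  proof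
    assume "y0 \<in> centralizer_in N x"
    then have "y0 [^] P \<in> center G" using pow_central x by blast
    moreover have "y0 [^] ord y0 \<in> center G"
      using y0c subgroup.one_closed[OF center_subgroup] by simp
    ultimately have "y0 \<in> center G"
      using subgroup_mem_coprime_pow[OF center_subgroup y0c] P_ord by blast
    then show False using y0n by blast
  qed
  have card_centralizer_in: "\<exists>e. card (centralizer_in N x) = p ^ e * card ?Z" if x: "x \<in> X1" for x
  proof -
    have xc: "x \<in> carrier G" using x part_carrier by blast
    have ZR: "?Z \<subseteq> centralizer_in N x" using central_in_centralizer_in xc by blast
    have cjZ: "conjugate z r \<in> ?Z" if "z \<in> ?Z" "r \<in> centralizer_in N x" for z r
      using that conjugate_center[of z r] centralizer_in_subset[of N x] by auto
    have ex: "r [^] (p ^ order G) \<in> ?Z" if r: "r \<in> centralizer_in N x" for r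
      using pow_central[OF x r] pow_in_N[of r] r centralizer_in_subset unfolding P_def by blast
    show ?thesis
      using card_eq_prime_power_mult[OF fin centralizer_in_N_subgroup[OF xc] Z ZR cjZ p ex] by metis
  qed
  \<comment> \<open>Comparing both orbit equations in \<open>N\<close>, the \<open>N\<close>-class
    size of \<open>y0\<close> divides that of \<open>x\<close> times a power of \<open>p\<close>.
    Being prime to the former it is a power of \<open>p\<close>, and not 1 because \<open>x\<close>
    and \<open>y0\<close> do not commute.\<close>
  have coprime_p: "coprime (card (class_in N x)) p" if x: "x \<in> X1" for x
  proof -
    have xc: "x \<in> carrier G" using x part_carrier by blast
    obtain e where e: "card (centralizer_in N x) = p ^ e * card ?Z" using card_centralizer_in x by blast
    have Zpos: "card ?Z > 0"
      using finite_N subgroup.one_closed[OF Z] by (metis card_gt_0_iff empty_iff finite_Int)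
    have cR: "subgroup (centralizer_in N y0) G" using centralizer_in_N_subgroup[OF y0c] .
    have "card ?Z dvd card (centralizer_in N y0)"
    proof (rule card_subgroup_dvd_stable[OF Z subgroup.subset[OF cR] finite_subset[OF centralizer_in_subset finite_N]])
      show "k \<otimes> r \<in> centralizer_in N y0" if "k \<in> ?Z" "r \<in> centralizer_in N y0" for k r
        using that central_in_centralizer_in[OF _ _ y0c] subgroup.m_closed[OF cR] by blast
    qed
    then obtain j where j: "card (centralizer_in N y0) = card ?Z * j" by blast
    have "card (class_in N y0) * card (centralizer_in N y0) = card (class_in N x) * card (centralizer_in N x)"
      using card_class_in_mult_centralizer_in[OF N_group] xc y0c by simp
    then have "(card (class_in N y0) * j) * card ?Z = (card (class_in N x) * p ^ e) * card ?Z"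
      unfolding j e by (simp only: mult_ac)
    then have "card (class_in N y0) * j = card (class_in N x) * p ^ e" using Zpos by simp
    then have "card (class_in N y0) dvd card (class_in N x) * p ^ e" by (metis dvd_triv_left)
    then have dvd: "card (class_in N y0) dvd p ^ e"
      using coprime_nsize[OF x y0X] by (simp add: coprime_commute coprime_dvd_mult_right_iff)
    have "card (class_in N y0) \<noteq> 1"
    proof
      assume 1: "card (class_in N y0) = 1"
      have "x \<otimes> y0 = y0 \<otimes> x" using card_class_in_eq_1[OF N_group y0c 1] part_subset x by blast
      then show False using y0_centralizer_in[OF x] part_subset y0X unfolding centralizer_in_def by auto
    qed
    then have "p dvd card (class_in N y0)"
      using dvd p by (metis divides_primepow_nat dvd_power not_gr0 power_0)
    then show ?thesis using coprime_nsize[OF x y0X] by (meson coprime_divisors dvd_refl)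
  qed
  have conjugate_centralizer_in: "conjugate r n \<in> centralizer_in N x" if x: "x \<in> X1" and r: "r \<in> centralizer_in N x" and n: "n \<in> N" for x r n
  proof -
    have xc: "x \<in> carrier G" using x part_carrier by blast
    have rN: "r \<in> N" using r centralizer_in_subset by blast
    have rc: "r \<in> carrier G" and nc: "n \<in> carrier G" using rN n by auto
    consider "r \<in> center G" | "r \<in> X1" | "r \<in> X2" using part_cases[OF rN] by blast
    then show ?thesis
    proof cases
      case 1
      then show ?thesis using conjugate_center nc r by simp
    next
      case 2
      then show ?thesis using X1_in_centralizer_in[OF x] conjugate_X1 nc by blast
    next
      case 3
      \<comment> \<open>\<open>N\<close> is the product of the centralizers of \<open>r\<close> and
        of \<open>x\<close>: the first factor fixes \<open>r\<close>, the second maps the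
        centralizer of \<open>x\<close> to itself.\<close>
      obtain b a where b: "b \<in> centralizer_in N r" and a: "a \<in> centralizer_in N x" and n_eq: "n = b \<otimes> a"
        using coprime_class_in_decompose[OF N_group xc rc coprime_nsize[OF x 3] n] .
      have bc: "b \<in> carrier G" "b \<otimes> r = r \<otimes> b" and ac: "a \<in> carrier G"
        using a b unfolding centralizer_in_def by auto
      have "conjugate r n = conjugate (conjugate r b) a" using n_eq bc ac rc by (simp add: conjugate_conjugate)
      also have "conjugate r b = r" using bc rc conjugate_eq_self_iff by blast
      also have "conjugate r a \<in> centralizer_in N x"
        using a r subgroup.m_closed[OF centralizer_in_N_subgroup[OF xc]] subgroup.m_inv_closed[OF centralizer_in_N_subgroup[OF xc]]
        unfolding conjugate_def by blast
      finally show ?thesis .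
    qed
  qed
  \<comment> \<open>Modulo the normal subgroup \<open>C_N(x)\<close>, the element \<open>r\<close>
    has order dividing a power of \<open>p\<close>, yet the index of that subgroup is prime to
    \<open>p\<close>.\<close>
  have centralizer_in_le: "centralizer_in N x' \<subseteq> centralizer_in N x" if x: "x \<in> X1" and x': "x' \<in> X1" for x x'
  proof
    fix r assume r: "r \<in> centralizer_in N x'"
    have xc: "x \<in> carrier G" using x part_carrier by blast
    have rN: "r \<in> N" using r centralizer_in_subset by blast
    have "r [^] P \<in> centralizer_in N x"
      using central_in_centralizer_in[OF pow_in_N[OF rN] pow_central[OF x' r] xc] .
    moreover have "r [^] card (class_in N x) \<in> centralizer_in N x"
      using pow_card_class_in_in_centralizer_in[OF N_group xc conjugate_centralizer_in[OF x] rN] by blast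
    moreover have "coprime P (card (class_in N x))"
      unfolding P_def using coprime_p[OF x] by (simp add: coprime_commute)
    ultimately show "r \<in> centralizer_in N x"
      using subgroup_mem_coprime_pow[OF centralizer_in_N_subgroup[OF xc] N.mem_carrier[OF rN]] by blast
  qed
  obtain x0 where x0: "x0 \<in> X1" using X1_nonempty by blast
  have xc: "x0 \<in> carrier G" using x0 part_carrier by blast
  define R where "R = centralizer_in N x0"
  have R: "subgroup R G" unfolding R_def using centralizer_in_N_subgroup[OF xc] .
  interpret R: subgroup R G by (rule R)
  have RN: "R \<subseteq> N" unfolding R_def by (rule centralizer_in_subset)
  have centralizer_in_eq: "centralizer_in N x = R" if "x \<in> X1" for x
    unfolding R_def using centralizer_in_le[OF x0 that] centralizer_in_le[OF that x0] by blast
  have X1R: "x \<in> R" if "x \<in> X1" for x unfolding R_def using X1_in_centralizer_in[OF x0 that] .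
  have X1_central: "x \<otimes> r = r \<otimes> x" if "x \<in> X1" "r \<in> R" for x r
    using centralizer_in_eq[OF that(1)] that(2) unfolding centralizer_in_def by auto
  have decomp: "\<exists>c\<in>centralizer_in N r. \<exists>u\<in>R. n = c \<otimes> u" if r: "r \<in> X2" and n: "n \<in> N" for r n
  proof -
    obtain b a where "b \<in> centralizer_in N r" "a \<in> centralizer_in N x0" "n = b \<otimes> a"
      using coprime_class_in_decompose[OF N_group xc part_carrier(2)[OF r] coprime_nsize[OF x0 r] n] .
    then show ?thesis unfolding R_def by blast
  qed
  \<comment> \<open>If \<open>R\<close> is not abelian, an element \<open>a\<close> of its second
    centre outside its centre \<open>Z1\<close> turns the commutator of \<open>x0\<close> and
    \<open>y0\<close> into a commutator of \<open>a\<close> with an element of \<open>R\<close>.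
    That is shown to be central in \<open>N\<close> and then to be trivial, although
    \<open>x0\<close> and \<open>y0\<close> do not commute.\<close>
  have comm_R: "r \<otimes> s = s \<otimes> r" if rs: "r \<in> R" "s \<in> R" for r s
  proof (rule ccontr)
    assume neq: "r \<otimes> s \<noteq> s \<otimes> r"
    let ?R = "G\<lparr>carrier := R\<rparr>"
    interpret GR: group ?R using R by (rule subgroup_imp_group)
    define Z1 where "Z1 = {z \<in> R. \<forall>g\<in>R. z \<otimes> g = g \<otimes> z}"
    have Z1: "center ?R = Z1" unfolding center_def Z1_def by simp
    have Z1_comm: "z \<otimes> g = g \<otimes> z" if "z \<in> Z1" "g \<in> R" for z g using that unfolding Z1_def by blast
    have Z1R: "z \<in> R" if "z \<in> Z1" for z using that unfolding Z1_def by blast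
    have Z1_sub: "subgroup Z1 G"
      using incl_subgroup[OF R GR.center_subgroup] unfolding Z1 .
    have X1Z1: "x \<in> Z1" if "x \<in> X1" for x using X1_central[OF that] X1R[OF that] unfolding Z1_def by blast
    have ZZ1: "?Z \<subseteq> Z1"
    proof
      fix z assume z: "z \<in> ?Z"
      then have "z \<in> R" unfolding R_def using central_in_centralizer_in xc by blast
      then show "z \<in> Z1" unfolding Z1_def using z center_commute R.mem_carrier by blast
    qed
    have X2I: "g \<in> X2" if "g \<in> R" "g \<notin> Z1" for g
      using part_cases[of g] that RN X1Z1 ZZ1 by blast
    obtain e where e: "card R = p ^ e * card ?Z" using card_centralizer_in[OF x0] unfolding R_def by blast
    have fR: "finite (carrier ?R)" using finite_subset[OF RN finite_N] by simp
    have ZsR: "subgroup ?Z ?R" using subgroup_incl[OF Z R] ZZ1 Z1R by blast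
    have ne: "center ?R \<noteq> carrier ?R" using neq rs unfolding Z1 unfolding Z1_def by auto
    obtain a where "a \<in> carrier ?R" "a \<notin> center ?R"
      and aZ': "\<And>r. r \<in> carrier ?R \<Longrightarrow> \<exists>z\<in>center ?R. GR.conjugate a r = a \<otimes>\<^bsub>?R\<^esub> z"
      using GR.exists_second_center_element[OF fR p ZsR _ _ ne, of e] ZZ1 e unfolding Z1 by (auto simp: order_def)
    then have a: "a \<in> R" "a \<notin> Z1" unfolding Z1 by auto
    have aZ: "\<exists>z\<in>Z1. conjugate a g = a \<otimes> z" if "g \<in> R" for g
      using aZ'[of g] that R unfolding Z1 GR.conjugate_def conjugate_def by simp
    have ac: "a \<in> carrier G" using a by simp
    have aX: "a \<in> X2" using X2I a by blast
    \<comment> \<open>Write \<open>n = c u\<close> with \<open>c\<close> centralizing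
      \<open>g\<close> and \<open>u\<close> in \<open>R\<close>. Since \<open>c\<close> fixes
      \<open>g\<close> and changes \<open>a\<close> only by a factor \<open>w\<close> from
      \<open>Z1\<close>, conjugating \<open>a g = g a z\<close> by \<open>c\<close> shows that
      \<open>c\<close> fixes \<open>z\<close>; and \<open>u\<close> fixes \<open>z\<close> because
      \<open>z\<close> is in \<open>Z1\<close>.\<close>
    have comm_N: "conjugate z n = z" if g: "g \<in> R" and z: "z \<in> Z1" and eq: "conjugate a g = a \<otimes> z" and n: "n \<in> N" for g z n
    proof (cases "g \<in> Z1")
      case True
      have zc: "z \<in> carrier G" using R.mem_carrier[OF Z1R[OF z]] .
      have "conjugate a g = a" using Z1_comm[OF True a(1)] conjugate_eq_self_iff[OF ac] g by simp
      then have "z = \<one>" using eq ac zc by simp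
      then show ?thesis using n by simp
    next
      case False
      have gX: "g \<in> X2" using X2I g False by blast
      have gc: "g \<in> carrier G" using g by simp
      have zc: "z \<in> carrier G" using R.mem_carrier[OF Z1R[OF z]] .
      obtain c u where c: "c \<in> centralizer_in N g" and u: "u \<in> R" and n_eq: "n = c \<otimes> u" using decomp[OF gX n] by blast
      have cN: "c \<in> N" and cg: "c \<otimes> g = g \<otimes> c" using c unfolding centralizer_in_def by auto
      have cc: "c \<in> carrier G" using cN by simp
      obtain d v where d: "d \<in> centralizer_in N a" and v: "v \<in> R" and c_eq: "c = d \<otimes> v" using decomp[OF aX cN] by blast
      have dc: "d \<in> carrier G" and da: "d \<otimes> a = a \<otimes> d" using d unfolding centralizer_in_def by auto
      have "conjugate a c = conjugate (conjugate a d) v" using c_eq dc v ac by (simp add: conjugate_conjugate)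
      also have "conjugate a d = a" using da ac dc conjugate_eq_self_iff by blast
      finally have cac: "conjugate a c = conjugate a v" .
      obtain w where w: "w \<in> Z1" and cav: "conjugate a v = a \<otimes> w" using aZ[OF v] by blast
      have wc: "w \<in> carrier G" using R.mem_carrier[OF Z1R[OF w]] .
      define z' where "z' = conjugate z c"
      have z'c: "z' \<in> carrier G" unfolding z'_def using zc cc by simp
      have cgg: "conjugate g c = g" using cg gc cc conjugate_eq_self_iff by blast
      have ag: "a \<otimes> g = g \<otimes> (a \<otimes> z)" using eq ac gc zc conjugate_eq_iff by simp
      have "(a \<otimes> w) \<otimes> g = conjugate (a \<otimes> g) c" using ac gc cc cgg cac cav by (simp add: conjugate_mult)
      also have "\<dots> = g \<otimes> ((a \<otimes> w) \<otimes> z')"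
        unfolding ag using ac gc cc zc cgg cac cav by (simp add: conjugate_mult z'_def)
      finally have 1: "(a \<otimes> w) \<otimes> g = g \<otimes> ((a \<otimes> w) \<otimes> z')" .
      have "(a \<otimes> w) \<otimes> g = (a \<otimes> g) \<otimes> w" using Z1_comm[OF w g] ac gc wc by (simp add: m_assoc)
      also have "\<dots> = g \<otimes> (a \<otimes> (z \<otimes> w))" unfolding ag using ac gc wc zc by (simp add: m_assoc)
      also have "z \<otimes> w = w \<otimes> z" using Z1_comm[OF z Z1R[OF w]] .
      finally have "g \<otimes> (a \<otimes> (w \<otimes> z)) = g \<otimes> (a \<otimes> (w \<otimes> z'))"
        using 1 ac gc wc zc z'c by (simp add: m_assoc)
      then have "z = z'" using ac gc wc zc z'c by simp
      then have "conjugate z n = conjugate z u" using n_eq cc u zc z'_def conjugate_conjugate[of z c u] by simp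
      also have "\<dots> = z" using Z1_comm[OF z u] conjugate_eq_self_iff[OF zc] u by simp
      finally show ?thesis .
    qed
    have xaR: "x0 \<otimes> a \<in> R" using X1R[OF x0] a by simp
    have "x0 \<otimes> a \<notin> Z1"
    proof
      assume "x0 \<otimes> a \<in> Z1"
      then have "inv x0 \<otimes> (x0 \<otimes> a) \<in> Z1"
        using X1Z1[OF x0] subgroup.m_closed[OF Z1_sub] subgroup.m_inv_closed[OF Z1_sub] by blast
      then show False using a xc ac by simp
    qed
    then have xaX: "x0 \<otimes> a \<in> X2" using X2I xaR by blast
    have y0N: "y0 \<in> N" using part_subset y0X by blast
    define k where "k = conjugate (inv x0) y0 \<otimes> x0"
    have kc: "k \<in> carrier G" unfolding k_def using xc y0c by simp
    \<comment> \<open>The factors \<open>x0^-1\<close> in \<open>X1\<close> and \<open>x0 a\<close>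
      in \<open>X2\<close> can be conjugated independently, so \<open>k a\<close> lies in the
      \<open>N\<close>-class of \<open>a\<close>. As \<open>N = C_N(a) R\<close> and
      \<open>R\<close> changes \<open>a\<close> only by factors from \<open>Z1\<close>,
      \<open>k\<close> is such a factor.\<close>
    have "conjugate (inv x0) y0 \<otimes> (x0 \<otimes> a) \<in> class_in N (inv x0 \<otimes> (x0 \<otimes> a))"
    proof (rule coprime_class_in_mult[OF N_group _ _ coprime_nsize[OF inv_X1[OF x0] xaX]])
      show "conjugate (inv x0) y0 \<in> class_in N (inv x0)" using y0N mem_class_in by blast
      show "x0 \<otimes> a \<in> class_in N (x0 \<otimes> a)" using class_in_self[OF N.subgroup_axioms] xc ac by simp
    qed (use xc ac in auto)
    then have "k \<otimes> a \<in> class_in N a" unfolding k_def using xc ac y0c by (simp add: m_assoc)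
    then obtain n where n: "n \<in> N" "k \<otimes> a = conjugate a n" using mem_class_in by blast
    obtain c u where c: "c \<in> centralizer_in N a" and u: "u \<in> R" and n_eq: "n = c \<otimes> u" using decomp[OF aX n(1)] by blast
    have cc: "c \<in> carrier G" and ca: "c \<otimes> a = a \<otimes> c" using c unfolding centralizer_in_def by auto
    obtain z where z: "z \<in> Z1" "conjugate a u = a \<otimes> z" using aZ[OF u] by blast
    have zc: "z \<in> carrier G" using R.mem_carrier[OF Z1R[OF z(1)]] .
    have "conjugate a n = conjugate (conjugate a c) u" using n_eq cc u ac by (simp add: conjugate_conjugate)
    also have "conjugate a c = a" using ca ac cc conjugate_eq_self_iff by blast
    also have "conjugate a u = z \<otimes> a" using z(2) Z1_comm[OF z(1) a(1)] by simp
    finally have "k \<otimes> a = z \<otimes> a" using n by simp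
    then have kz: "k = z" using kc zc ac by simp
    have k_comm: "k \<otimes> n = n \<otimes> k" if "n \<in> N" for n
    proof -
      have "conjugate k n = k" unfolding kz using comm_N[OF u z that] .
      then show ?thesis using conjugate_eq_self_iff[OF kc, of n] that by simp
    qed
    have cjy: "conjugate y0 x0 = y0 \<otimes> k" unfolding k_def using xc y0c by (simp add: conjugate_def m_assoc)
    \<comment> \<open>\<open>k\<close> is both the factor by which \<open>x0\<close> changes
      \<open>y0\<close> and the factor by which \<open>y0\<close> changes \<open>x0^-1\<close>.
      Hence \<open>k\<close> is annihilated by \<open>ord y0\<close> and by \<open>P\<close>, which
      are coprime.\<close>
    have k1: "k [^] ord y0 = \<one>"
    proof (rule commutator_pow_eq_one[OF y0c xc kc cjy])
      show "y0 \<otimes> k = k \<otimes> y0" using k_comm[OF y0N] by simp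
    qed (use y0c xc in simp)
    have ix: "inv x0 \<in> N" "inv x0 \<in> carrier G" using part_subset x0 xc by auto
    have "conjugate (inv x0) y0 = k \<otimes> inv x0" unfolding k_def using xc y0c by (simp add: m_assoc)
    then have cjx: "conjugate (inv x0) y0 = inv x0 \<otimes> k" using k_comm[OF ix(1)] by simp
    have "inv x0 [^] P \<in> center G"
      using pow_central[OF inv_X1[OF x0] X1_in_centralizer_in[OF inv_X1[OF x0] inv_X1[OF x0]]] .
    then have "y0 \<otimes> inv x0 [^] P = inv x0 [^] P \<otimes> y0" using center_commute[OF _ y0c] by simp
    then have k2: "k [^] P = \<one>"
      using commutator_pow_eq_one[OF ix(2) y0c kc cjx k_comm[OF ix(1), symmetric]] by blast
    have "k = \<one>" using pow_coprime_eq_one[OF kc k2 k1 P_ord] .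
    then have "conjugate y0 x0 = y0" using cjy y0c by simp
    then have "x0 \<otimes> y0 = y0 \<otimes> x0" using conjugate_eq_self_iff[OF y0c xc] by blast
    then have "y0 \<in> centralizer_in N x0" using y0N unfolding centralizer_in_def by simp
    then show False using y0_centralizer_in[OF x0] by blast
  qed
  \<comment> \<open>\<open>N = C_N(s) R\<close> and both factors centralize \<open>s\<close>, the
    second because \<open>R\<close> is abelian. So such an \<open>s\<close>, though not central in
    \<open>G\<close>, is central in \<open>N\<close>.\<close>
  have X2_central: "s \<otimes> n = n \<otimes> s" if s: "s \<in> X2" "s \<in> R" and n: "n \<in> N" for s n
  proof -
    obtain c u where c: "c \<in> centralizer_in N s" and u: "u \<in> R" and n_eq: "n = c \<otimes> u" using decomp[OF s(1) n] by blast
    have cc: "c \<in> carrier G" "c \<otimes> s = s \<otimes> c" using c unfolding centralizer_in_def by auto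
    show ?thesis
      unfolding n_eq using commute_mult[OF cc(1) R.mem_carrier[OF u] R.mem_carrier[OF s(2)] cc(2) comm_R[OF u s(2)]] by simp
  qed
  have outside: "y \<in> X2" if "y \<in> N" "y \<notin> R" for y
    using that part_cases[of y] X1R[of y] central_in_centralizer_in[OF that(1) _ xc]
    unfolding R_def by blast
  have central: "s \<otimes> n = n \<otimes> s"
    if y: "y \<in> N" "y \<notin> R" and s: "s \<in> R" and ys: "y \<otimes> s = s \<otimes> y" and n: "n \<in> N" for y s n
  proof -
    have sN: "s \<in> N" using s RN by blast
    have "s \<notin> X1"
    proof
      assume sX: "s \<in> X1"
      have "y \<in> centralizer_in N s" using y ys unfolding centralizer_in_def by simp
      then show False using centralizer_in_eq[OF sX] y by blast
    qed
    then consider "s \<in> center G" | "s \<in> X2" using part_cases[OF sN] by blast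
    then show ?thesis
    proof cases
      case 1
      then show ?thesis using center_commute[OF 1 N.mem_carrier[OF n]] by blast
    next
      case 2
      then show ?thesis using X2_central[OF 2 s n] by blast
    qed
  qed
  have y0R: "y0 \<in> N" "y0 \<notin> R" using part_subset y0X y0_centralizer_in[OF x0] unfolding R_def by auto
  have conjugate_R: "conjugate r n \<in> R" if "r \<in> R" "n \<in> N" for r n
    using conjugate_centralizer_in[OF x0 that(1)[unfolded R_def] that(2)] unfolding R_def .
  show ?thesis
    using quasi_frobenius_of_abelian_centralizer_in[OF x0, folded R_def, OF comm_R conjugate_R y0R outside central] .
qed

lemma dichotomy:
  "quasi_frobenius_alternative \<or>
    (\<exists>P A p. internal_direct_product (G\<lparr>carrier := N\<rparr>) P A \<and>
      p_group p (G\<lparr>carrier := P\<rparr>) \<and> A \<subseteq> center G)"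
proof (cases "\<exists>x\<in>X1. \<forall>y\<in>centralizer_in N x. y \<notin> X2")
  case True
  then show ?thesis using alternative_if_centralizer_in_avoids_X2 by blast
next
  case False
  then have meet: "\<exists>y\<in>centralizer_in N x. y \<in> X2" if "x \<in> X1" for x using that by blast
  have pos: "order G > 0" using fin by (simp add: order_gt_0_iff_finite)
  have prime_part: "\<exists>(p::nat) (k::nat) (e::nat). prime p \<and> u [^] k \<notin> center G \<and> (u [^] k) [^] (p ^ e) = \<one>"
    if "u \<in> carrier G" "u \<notin> center G" for u
    using exists_prime_power_part_notin[OF center_subgroup pos pow_order_eq_1[OF that(1)] that] by blast
  obtain x where x: "x \<in> X1" using X1_nonempty by blast
  obtain p k e :: nat where p: "prime p" and k: "x [^] k \<notin> center G" and e: "(x [^] k) [^] (p ^ e) = \<one>"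
    using prime_part part_carrier(1)[OF x] part_noncentral(1)[OF x] by metis
  define x1 where "x1 = x [^] k"
  have x1: "x1 \<in> X1" unfolding x1_def using pow_X1[OF x k] .
  have x1c: "x1 \<in> carrier G" using x1 part_carrier by blast
  have x1_ord: "ord x1 dvd p ^ e" using e x1c unfolding x1_def by (simp add: pow_eq_id)
  define P where "P = p ^ order G"
  \<comment> \<open>Otherwise \<open>v = u^P\<close> has order prime to \<open>p\<close>, and
    \<open>w = x1 v\<close> is an element of \<open>X1\<close> whose centralizer centralizes both
    \<open>x1\<close> and \<open>v\<close>. By \<open>meet\<close> it contains an element of
    \<open>X2\<close>, which clashes with \<open>x1\<close> or with \<open>v\<close>.\<close>
  have X1_pow: "u [^] P \<in> center G" if u: "u \<in> X1" for u
  proof (rule ccontr)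
    assume "u [^] P \<notin> center G"
    define v where "v = u [^] P"
    have v: "v \<in> X1" unfolding v_def using pow_X1[OF u] \<open>u [^] P \<notin> center G\<close> by blast
    have vc: "v \<in> carrier G" using v part_carrier by blast
    have v_ord: "coprime (ord v) p"
      unfolding v_def P_def using coprime_ord_pow_order[OF fin part_carrier(1)[OF u]] .
    have cop: "coprime (ord x1) (ord v)"
    proof -
      have "coprime (p ^ e) (ord v)" using v_ord by (simp add: coprime_commute)
      then show ?thesis using x1_ord by (meson coprime_divisors dvd_refl)
    qed
    have comm: "x1 \<otimes> v = v \<otimes> x1" using X1_commute[OF x1 v] .
    define w where "w = x1 \<otimes> v"
    have wN: "w \<in> N" unfolding w_def using part_subset x1 v by blast
    have wc: "w \<in> carrier G" using wN by simp
    have c1: "g \<otimes> x1 = x1 \<otimes> g" if "g \<in> carrier G" "g \<otimes> w = w \<otimes> g" for g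
      using commute_of_commute_mult_coprime[OF x1c vc that(1) comm cop] that(2) unfolding w_def by blast
    have c2: "g \<otimes> v = v \<otimes> g" if "g \<in> carrier G" "g \<otimes> w = w \<otimes> g" for g
      using commute_of_commute_mult_coprime[OF vc x1c that(1) comm[symmetric]] that(2) cop
      unfolding w_def comm by (simp add: coprime_commute)
    have "centralizer_in (carrier G) w \<subseteq> centralizer_in (carrier G) x1" using c1 unfolding centralizer_in_def by blast
    then have dv: "csize x1 dvd csize w"
      using card_class_in_dvd_of_centralizer_in_subset[OF carrier_group wc x1c] by blast
    have x1_1: "csize x1 \<noteq> 1" using csize_neq_1[OF x1c] part_noncentral(1)[OF x1] by blast
    have wn: "w \<notin> center G"
    proof
      assume "w \<in> center G"
      then have "x1 \<in> center G"
        using centerI[OF x1c] c1 center_commute[of w] by metis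
      then show False using part_noncentral(1)[OF x1] by blast
    qed
    have "w \<notin> X2" using csize_coprime_dvd[OF x1 _ dvd_refl dv] x1_1 by blast
    then have wX: "w \<in> X1" using part_cases[OF wN wn] by blast
    obtain y where y: "y \<in> centralizer_in N w" "y \<in> X2" using meet[OF wX] by blast
    have yc: "y \<in> carrier G" using y part_carrier by blast
    obtain q l f :: nat where q: "prime q" and l: "y [^] l \<notin> center G" and f: "(y [^] l) [^] (q ^ f) = \<one>"
      using prime_part[OF yc part_noncentral(2)[OF y(2)]] by metis
    define y' where "y' = y [^] l"
    have y': "y' \<in> X2" unfolding y'_def using pow_X2[OF y(2) l] .
    have y'c: "y' \<in> carrier G" using y' part_carrier by blast
    have y'_ord: "ord y' dvd q ^ f" using f y'c unfolding y'_def by (simp add: pow_eq_id)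
    have "y \<otimes> w = w \<otimes> y" using y unfolding centralizer_in_def by blast
    then have y'w: "y' \<otimes> w = w \<otimes> y'" unfolding y'_def using commute_pow[OF yc wc] by blast
    show False
    \<comment> \<open>Whatever the prime \<open>q\<close>, it differs from the primes of
      \<open>ord v\<close> or from \<open>p\<close>; so \<open>y'\<close> commutes with an element
      of \<open>X1\<close> of coprime order.\<close>
    proof (cases "q = p")
      case True
      have "coprime (q ^ f) (ord v)" using v_ord True by (simp add: coprime_commute)
      then have "coprime (ord v) (ord y')" using y'_ord by (meson coprime_commute coprime_divisors dvd_refl)
      then show False using not_commute_coprime[OF v y'] c2[OF y'c y'w] by simp
    next
      case False
      have "coprime (p ^ e) (q ^ f)" using p q False by (simp add: primes_coprime)
      then have "coprime (ord x1) (ord y')" using x1_ord y'_ord by (meson coprime_divisors)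
      then show False using not_commute_coprime[OF x1 y'] c1[OF y'c y'w] by simp
    qed
  qed
  have pow_central: "c [^] P \<in> center G" if u: "u \<in> X1" and c: "c \<in> centralizer_in N u" for u c
  proof (rule ccontr)
    assume nc: "c [^] P \<notin> center G"
    have uc: "u \<in> carrier G" using u part_carrier by blast
    have cN: "c \<in> N" and cu: "c \<otimes> u = u \<otimes> c" using c unfolding centralizer_in_def by auto
    have cc: "c \<in> carrier G" using cN by simp
    obtain q l f :: nat where q: "prime q" and l: "u [^] l \<notin> center G" and f: "(u [^] l) [^] (q ^ f) = \<one>"
      using prime_part[OF uc part_noncentral(1)[OF u]] by metis
    define u' where "u' = u [^] l"
    have u': "u' \<in> X1" unfolding u'_def using pow_X1[OF u l] .
    have u'c: "u' \<in> carrier G" using u' part_carrier by blast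
    \<comment> \<open>For another prime, both \<open>u'^P\<close> and a \<open>q\<close>-power of
      \<open>u'\<close> would be central, hence \<open>u'\<close> itself.\<close>
    have "q = p"
    proof (rule ccontr)
      assume "q \<noteq> p"
      then have "coprime P (q ^ f)" unfolding P_def using p q by (simp add: primes_coprime)
      moreover have "u' [^] (q ^ f) \<in> center G"
        using f subgroup.one_closed[OF center_subgroup] unfolding u'_def by simp
      ultimately have "u' \<in> center G"
        using subgroup_mem_coprime_pow[OF center_subgroup u'c X1_pow[OF u']] by blast
      then show False using part_noncentral(1)[OF u'] by blast
    qed
    then have u'_ord: "ord u' dvd p ^ f" using f u'c unfolding u'_def by (simp add: pow_eq_id)
    \<comment> \<open>\<open>d\<close> has order prime to \<open>p\<close>. It is not in
      \<open>X1\<close>, where \<open>P\<close>-th powers are central, so it is in \<open>X2\<close>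
      and commutes with the \<open>p\<close>-element \<open>u'\<close>.\<close>
    define d where "d = c [^] P"
    have dc: "d \<in> carrier G" and dN: "d \<in> N" unfolding d_def using pow_in_N[OF cN] cc by auto
    have d_ord: "coprime (ord d) p" unfolding d_def P_def using coprime_ord_pow_order[OF fin cc] .
    have dn: "d \<notin> center G" using nc unfolding d_def .
    have "d \<notin> X1"
    proof
      assume dX: "d \<in> X1"
      have "d [^] ord d \<in> center G" using dc subgroup.one_closed[OF center_subgroup] by simp
      moreover have "coprime P (ord d)" unfolding P_def using d_ord by (simp add: coprime_commute)
      ultimately show False
        using subgroup_mem_coprime_pow[OF center_subgroup dc X1_pow[OF dX]] dn by blast
    qed
    then have dX: "d \<in> X2" using part_cases[OF dN dn] by blast
    have "d \<otimes> u = u \<otimes> d" unfolding d_def using commute_pow[OF cc uc cu] .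
    then have "u' \<otimes> d = d \<otimes> u'" unfolding u'_def using commute_pow[OF uc dc] by simp
    moreover have "coprime (p ^ f) (ord d)" using d_ord by (simp add: coprime_commute)
    then have "coprime (ord u') (ord d)" using u'_ord by (meson coprime_divisors dvd_refl)
    ultimately show False using not_commute_coprime[OF u' dX] by blast
  qed
  show ?thesis
  proof (cases "\<forall>y\<in>X2. y [^] P \<in> center G")
    case False
    then obtain y where "y \<in> X2" "y [^] P \<notin> center G" by blast
    then show ?thesis
      using alternative_if_p'_element[OF p] pow_central unfolding P_def by blast
  next
    case True
    have "n [^] (p ^ order G) \<in> center G" if n: "n \<in> N" for n
    proof (cases "n \<in> center G")
      case True
      then show ?thesis using subgroup_pow_closed[OF center_subgroup] by blast
    next
      case False
      then show ?thesis
        using part_cases[OF n] X1_pow \<open>\<forall>y\<in>X2. y [^] P \<in> center G\<close> unfolding P_def by blast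
    qed
    then show ?thesis
      using p_group_times_central[OF fin N.subgroup_axioms p] by blast
  qed
qed

end

section \<open>Connected components of the class graph\<close>

text \<open>A common prime divisor would give arcs in both directions and so put the two classes
  into one strongly connected component.\<close>

lemma two_components_partition:
  assumes fin: "finite N" and two: "card (components (class_graph G N)) = 2"
  obtains C1 C2 where "C1 \<noteq> {}" "C2 \<noteq> {}"
    "{conj_class G x | x. x \<in> N \<and> x \<notin> center G} = C1 \<union> C2"
    "\<forall>C\<in>C1. \<forall>D\<in>C2. coprime (card C) (card D)"
proof -
  let ?\<Gamma> = "class_graph G N"
  interpret pair_graph ?\<Gamma> using fin by (rule class_graph_pair_graph)
  have comp: "components ?\<Gamma> = pre_digraph.sccs_verts (with_proj ?\<Gamma>)"
    by (simp add: components_def)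
  obtain C1 C2 where C: "components ?\<Gamma> = {C1, C2}" "C1 \<noteq> C2"
    using two by (meson card_2_iff)
  have V: "pverts ?\<Gamma> = {conj_class G x | x. x \<in> N \<and> x \<notin> center G}"
    by (simp add: class_graph_def Let_def)
  have sub: "C1 \<union> C2 \<subseteq> pverts ?\<Gamma>"
    using sccs_verts_subsets C(1) comp by auto
  have "pverts ?\<Gamma> \<subseteq> C1 \<union> C2"
  proof
    fix v assume "v \<in> pverts ?\<Gamma>"
    then have "scc_of v \<in> sccs_verts" "v \<in> scc_of v"
      using scc_of_in_sccs_verts in_scc_of_self by auto
    then show "v \<in> C1 \<union> C2" using C(1) comp by auto
  qed
  with sub have un: "pverts ?\<Gamma> = C1 \<union> C2" by blast
  have mem: "C1 \<in> sccs_verts" "C2 \<in> sccs_verts" using C(1) comp by auto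
  have disj: "C1 \<inter> C2 = {}" using sccs_verts_disjoint[OF mem C(2)] .
  have ne: "C1 \<noteq> {}" "C2 \<noteq> {}" using mem by (auto simp: in_sccs_verts_conv_reachable)
  have cop: "coprime (card C) (card D)" if CD: "C \<in> C1" "D \<in> C2" for C D
  proof (rule ccontr)
    assume "\<not> coprime (card C) (card D)"
    then have "gcd (card C) (card D) \<noteq> 1" by (simp add: coprime_iff_gcd_eq_1)
    then obtain p where "prime p" "p dvd gcd (card C) (card D)"
      using prime_factor_nat by blast
    then have p: "prime p" "p dvd card C" "p dvd card D" by auto
    have "C \<noteq> D" using CD disj by blast
    then have arcs: "(C, D) \<in> parcs ?\<Gamma>" "(D, C) \<in> parcs ?\<Gamma>"
      using p CD un unfolding V unfolding class_graph_def Let_def by auto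
    then have "C \<rightarrow>\<^sup>*\<^bsub>with_proj ?\<Gamma>\<^esub> D" "D \<rightarrow>\<^sup>*\<^bsub>with_proj ?\<Gamma>\<^esub> C"
      by (auto intro!: reachable_adjI)
    moreover have "D \<notin> C1" using CD disj by blast
    ultimately show False using mem(1) CD(1) by (auto simp: in_sccs_verts_conv_reachable)
  qed
  have "{conj_class G x | x. x \<in> N \<and> x \<notin> center G} = C1 \<union> C2" using un V by simp
  then show thesis using that[OF ne] cop by blast
qed

lemma (in group) two_components_dichotomy:
  assumes fin: "finite (carrier G)" and N: "N \<lhd> G"
    and two: "card (components (class_graph G N)) = 2"
  shows "(quasi_frobenius (G\<lparr>carrier := N\<rparr>) \<and>
           (\<exists>K L. quasi_frobenius_kernel_complement (G\<lparr>carrier := N\<rparr>) K L \<and>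
                  comm_group (G\<lparr>carrier := K\<rparr>) \<and> comm_group (G\<lparr>carrier := L\<rparr>)))
       \<or> (\<exists>P A p. internal_direct_product (G\<lparr>carrier := N\<rparr>) P A \<and>
                  p_group p (G\<lparr>carrier := P\<rparr>) \<and> A \<subseteq> center G)"
proof -
  interpret N: normal N G by (rule N)
  have finN: "finite N" using finite_subset[OF N.subset fin] .
  obtain C1 C2 where C: "C1 \<noteq> {}" "C2 \<noteq> {}"
    and un: "{conj_class G x | x. x \<in> N \<and> x \<notin> center G} = C1 \<union> C2"
    and cop: "\<forall>C\<in>C1. \<forall>D\<in>C2. coprime (card C) (card D)"
    by (rule two_components_partition[OF finN two])
  let ?size = "\<lambda>x. card (class_in (carrier G) x)"
  define U where "U = N - center G"
  define X where "X E = {x \<in> U. class_in (carrier G) x \<in> E}" for E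
  have img: "class_in (carrier G) ` U = C1 \<union> C2"
    unfolding un[symmetric] U_def conj_class_eq_class_in by blast
  have U: "U = X C1 \<union> X C2"
  proof (intro equalityI subsetI)
    fix x assume x: "x \<in> U"
    then have "class_in (carrier G) x \<in> C1 \<union> C2" unfolding img[symmetric] by (rule imageI)
    then show "x \<in> X C1 \<union> X C2" using x unfolding X_def by simp
  qed (auto simp: X_def)
  have X_ne: "X E \<noteq> {}" if E: "E \<noteq> {}" "E \<subseteq> C1 \<union> C2" for E
  proof -
    obtain D where D: "D \<in> E" using E(1) by blast
    then have "D \<in> class_in (carrier G) ` U" unfolding img using E(2) by (rule rev_subsetD)
    then obtain x where "x \<in> U" "D = class_in (carrier G) x" by (rule imageE) simp
    then show ?thesis using D unfolding X_def by blast
  qed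
  have ne: "X C1 \<noteq> {}" "X C2 \<noteq> {}" using X_ne C by simp_all
  have coprime_X: "coprime (?size x) (?size y)" if "x \<in> X C1" "y \<in> X C2" for x y
    using that cop unfolding X_def by simp
  have finU: "finite (?size ` U)" using finN unfolding U_def by simp
  have neU: "?size ` U \<noteq> {}" using ne U by simp
  obtain b where b: "Max (?size ` U) = ?size b" "b \<in> U"
    using Max_in[OF finU neU] by (rule imageE)
  have max: "?size x \<le> ?size b" if "x \<in> U" for x
    unfolding b(1)[symmetric] by (rule Max_ge[OF finU imageI[OF that]])
  \<comment> \<open>The two components enter symmetrically; the one containing the class of
    \<open>b\<close> takes the place of \<open>X2\<close>.\<close>
  have main: ?thesis if "U = X1 \<union> X2" "X1 \<noteq> {}" "b \<in> X2"
    "\<And>x y. x \<in> X1 \<Longrightarrow> y \<in> X2 \<Longrightarrow> coprime (?size x) (?size y)" for X1 X2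
  proof -
    interpret coprime_class_partition G N X1 X2 b
      by unfold_locales (use fin N that max in \<open>auto simp: U_def\<close>)
    show ?thesis by (rule dichotomy)
  qed
  show ?thesis
  proof (cases "b \<in> X C2")
    case True
    then show ?thesis by (intro main[OF U ne(1) True] coprime_X)
  next
    case False
    then have bX: "b \<in> X C1" using b U by blast
    have eq: "U = X C2 \<union> X C1" using U by blast
    have "coprime (?size x) (?size y)" if "x \<in> X C2" "y \<in> X C1" for x y
      using coprime_X[OF that(2,1)] by (simp add: coprime_commute)
    then show ?thesis by (rule main[OF eq ne(2) bX])
  qed
qed

theorem theoremE:
  fixes G :: "('a, 'b) monoid_scheme" and N :: "'a set"
  assumes "group G"
    and "finite (carrier G)"
    and "N \<lhd> G"
    and "card (components (class_graph G N)) = 2"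
  shows "(quasi_frobenius (G\<lparr>carrier := N\<rparr>) \<and>
           (\<exists>K L. quasi_frobenius_kernel_complement (G\<lparr>carrier := N\<rparr>) K L \<and>
                  comm_group (G\<lparr>carrier := K\<rparr>) \<and> comm_group (G\<lparr>carrier := L\<rparr>)))
       \<or> (\<exists>P A p. internal_direct_product (G\<lparr>carrier := N\<rparr>) P A \<and>
                  p_group p (G\<lparr>carrier := P\<rparr>) \<and> A \<subseteq> center G)"
  using assms by (rule group.two_components_dichotomy)

end
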